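(* Let $\Omega=(0,1)\times(0,1)$, let $\varphi\in L^1(0,1)$ with $\varphi\not\equiv 0$, and let $g_0,g_1\in L^2(\Omega)$. Let $u_1,u_2\in C^1([0,1];L^2(\Omega))\cap L^2(0,1;H^2(\Omega))$ and $f_1,f_2\in L^2(\Omega)$. If both pairs $(u_1,f_1)$ and $(u_2,f_2)$ solve the source problem with data $(\varphi,g_0,g_1)$ (defined in the context), then $(u_1,f_1)=(u_2,f_2)$.
   Context: Functions are real-valued. A pair $(u,f)$ with $u\in C^1([0,1];L^2(\Omega))\cap L^2(0,1;H^2(\Omega))$ and $f\in L^2(\Omega)$ solves the source problem with data $(\varphi,g_0,g_1)$ if $$u_t-\Delta u=\varphi(t)f(x,y)\quad\text{for } t\in(0,1),\ (x,y)\in\Omega,$$ $$u_x(0,y,t)=u_x(1,y,t)=u_y(x,0,t)=u_y(x,1,t)=0,\qquad u(1,y,t)=0$$ for $x,y,t\in(0,1)$, and $$u(x,y,0)=g_0(x,y),\qquad u(x,y,1)=g_1(x,y)\quad\text{in }\Omega.$$ Here the equation is understood in $L^2(\Omega)$ for a.e. $t$, and the boundary values in the sense of traces for a.e. $t$. *)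

theory Defs
  imports "HOL-Analysis.Analysis"
begin

text \<open>
  Elements of Lebesgue and Sobolev spaces are represented by functions, and equality in these
  spaces is equality almost everywhere. The distances \<open>L2_norm\<close> and \<open>sobolev_norm\<close> are only
  meaningful on members of the respective space, since a Bochner integral that does not exist
  has the value 0; they are used below only where membership is required as well.
\<close>

definition L2 :: "'a::euclidean_space set \<Rightarrow> ('a \<Rightarrow> real) set" where
  "L2 S = {f. f \<in> borel_measurable (lebesgue_on S) \<and> integrable (lebesgue_on S) (\<lambda>x. (f x)\<^sup>2)}"

definition L2_norm :: "'a::euclidean_space set \<Rightarrow> ('a \<Rightarrow> real) \<Rightarrow> real" where
  "L2_norm S f = sqrt (LINT x|lebesgue_on S. (f x)\<^sup>2)"


subsection \<open>Weak derivatives and Sobolev spaces in the plane\<close>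

definition partial_deriv :: "real \<times> real \<Rightarrow> (real \<times> real \<Rightarrow> real) \<Rightarrow> real \<times> real \<Rightarrow> real" where
  "partial_deriv e h = (\<lambda>p. frechet_derivative h (at p) e)"

fun multi_deriv :: "nat \<times> nat \<Rightarrow> (real \<times> real \<Rightarrow> real) \<Rightarrow> real \<times> real \<Rightarrow> real" where
  "multi_deriv (i, j) h = (partial_deriv (1, 0) ^^ i) ((partial_deriv (0, 1) ^^ j) h)"

primrec C_k :: "nat \<Rightarrow> (real \<times> real \<Rightarrow> real) \<Rightarrow> bool" where
  "C_k 0 h \<longleftrightarrow> continuous_on UNIV h"
| "C_k (Suc k) h \<longleftrightarrow>
     (\<forall>p. h differentiable (at p)) \<and> C_k k (partial_deriv (1, 0) h) \<and> C_k k (partial_deriv (0, 1) h)"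

definition smooth :: "(real \<times> real \<Rightarrow> real) \<Rightarrow> bool" where
  "smooth h \<longleftrightarrow> (\<forall>k. C_k k h)"

definition test_function :: "(real \<times> real) set \<Rightarrow> (real \<times> real \<Rightarrow> real) \<Rightarrow> bool" where
  "test_function S h \<longleftrightarrow>
     smooth h \<and> compact (closure {p. h p \<noteq> 0}) \<and> closure {p. h p \<noteq> 0} \<subseteq> S"

definition has_weak_deriv ::
  "(real \<times> real) set \<Rightarrow> nat \<times> nat \<Rightarrow> (real \<times> real \<Rightarrow> real) \<Rightarrow> (real \<times> real \<Rightarrow> real) \<Rightarrow> bool" where
  "has_weak_deriv S \<alpha> v g \<longleftrightarrow> v \<in> L2 S \<and> g \<in> L2 S \<and>
     (\<forall>h. test_function S h \<longrightarrow>
        (LINT p|lebesgue_on S. v p * multi_deriv \<alpha> h p)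
          = (-1) ^ (fst \<alpha> + snd \<alpha>) * (LINT p|lebesgue_on S. g p * h p))"

text \<open>A representative of the weak derivative, which is unique up to null sets on open \<open>S\<close>.\<close>

definition weak_deriv ::
  "(real \<times> real) set \<Rightarrow> nat \<times> nat \<Rightarrow> (real \<times> real \<Rightarrow> real) \<Rightarrow> real \<times> real \<Rightarrow> real" where
  "weak_deriv S \<alpha> v = (SOME g. has_weak_deriv S \<alpha> v g)"

definition sobolev :: "nat \<Rightarrow> (real \<times> real) set \<Rightarrow> (real \<times> real \<Rightarrow> real) set" where
  "sobolev k S = {v \<in> L2 S. \<forall>\<alpha>. fst \<alpha> + snd \<alpha> \<le> k \<longrightarrow> (\<exists>g. has_weak_deriv S \<alpha> v g)}"

definition sobolev_norm :: "nat \<Rightarrow> (real \<times> real) set \<Rightarrow> (real \<times> real \<Rightarrow> real) \<Rightarrow> real" where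
  "sobolev_norm k S v = sqrt (\<Sum>\<alpha> | fst \<alpha> + snd \<alpha> \<le> k. (L2_norm S (weak_deriv S \<alpha> v))\<^sup>2)"

definition laplacian :: "(real \<times> real) set \<Rightarrow> (real \<times> real \<Rightarrow> real) \<Rightarrow> real \<times> real \<Rightarrow> real" where
  "laplacian S v = (\<lambda>p. weak_deriv S (2, 0) v p + weak_deriv S (0, 2) v p)"


subsection \<open>Traces on the sides of the unit square\<close>

definition unit_square :: "(real \<times> real) set" where
  "unit_square = {0<..<1} \<times> {0<..<1}"

text \<open>
  The trace operator is the continuous extension to \<open>H\<^sup>1\<close>, with values in \<open>L\<^sup>2\<close> of the side, of
  the restriction map on functions that are smooth up to the boundary. The relation below is
  the graph of this extension; \<open>\<gamma>\<close> is an arc length parametrisation of the side over \<open>(0,1)\<close>.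
\<close>

definition has_trace ::
  "(real \<Rightarrow> real \<times> real) \<Rightarrow> (real \<times> real \<Rightarrow> real) \<Rightarrow> (real \<Rightarrow> real) \<Rightarrow> bool" where
  "has_trace \<gamma> v w \<longleftrightarrow> v \<in> sobolev 1 unit_square \<and> w \<in> L2 {0<..<1} \<and>
     (\<exists>V. (\<forall>n. smooth (V n)) \<and>
        (\<lambda>n::nat. sobolev_norm 1 unit_square (\<lambda>p. V n p - v p)) \<longlonglongrightarrow> 0 \<and>
        (\<lambda>n. L2_norm {0<..<1} (\<lambda>s. V n (\<gamma> s) - w s)) \<longlonglongrightarrow> 0)"


subsection \<open>Curves in function spaces\<close>

definition has_L2_time_deriv ::
  "(real \<times> real) set \<Rightarrow> (real \<Rightarrow> real \<times> real \<Rightarrow> real) \<Rightarrow> (real \<times> real \<Rightarrow> real) \<Rightarrow> real \<Rightarrow> bool" where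
  "has_L2_time_deriv S u d t \<longleftrightarrow> d \<in> L2 S \<and>
     ((\<lambda>s. L2_norm S (\<lambda>p. (u s p - u t p) / (s - t) - d p)) \<longlongrightarrow> 0) (at t within {0..1})"

definition time_deriv ::
  "(real \<times> real) set \<Rightarrow> (real \<Rightarrow> real \<times> real \<Rightarrow> real) \<Rightarrow> real \<Rightarrow> real \<times> real \<Rightarrow> real" where
  "time_deriv S u t = (SOME d. has_L2_time_deriv S u d t)"

definition C1_L2 :: "(real \<times> real) set \<Rightarrow> (real \<Rightarrow> real \<times> real \<Rightarrow> real) set" where
  "C1_L2 S = {u. (\<forall>t\<in>{0..1}. u t \<in> L2 S) \<and>
     (\<exists>u'. \<forall>t\<in>{0..1}. has_L2_time_deriv S u (u' t) t \<and>
        ((\<lambda>s. L2_norm S (\<lambda>p. u' s p - u' t p)) \<longlongrightarrow> 0) (at t within {0..1}))}"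

text \<open>The Bochner space \<open>L\<^sup>2(0,1;H\<^sup>2(S))\<close>: strongly measurable with square integrable norm.\<close>

definition L2_H2 :: "(real \<times> real) set \<Rightarrow> (real \<Rightarrow> real \<times> real \<Rightarrow> real) set" where
  "L2_H2 S = {u. (AE t in lebesgue_on {0<..<1}. u t \<in> sobolev 2 S) \<and>
     (\<exists>s. (\<forall>n. simple_function (lebesgue_on {0<..<1}) (s n) \<and> s n ` {0<..<1} \<subseteq> sobolev 2 S) \<and>
        (AE t in lebesgue_on {0<..<1}.
           (\<lambda>n::nat. sobolev_norm 2 S (\<lambda>p. u t p - s n t p)) \<longlonglongrightarrow> 0)) \<and>
     integrable (lebesgue_on {0<..<1}) (\<lambda>t. (sobolev_norm 2 S (u t))\<^sup>2)}"


subsection \<open>The source problem\<close>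

definition solves_source_problem ::
  "(real \<Rightarrow> real) \<Rightarrow> (real \<times> real \<Rightarrow> real) \<Rightarrow> (real \<times> real \<Rightarrow> real) \<Rightarrow>
   (real \<Rightarrow> real \<times> real \<Rightarrow> real) \<Rightarrow> (real \<times> real \<Rightarrow> real) \<Rightarrow> bool" where
  "solves_source_problem \<phi> g0 g1 u f \<longleftrightarrow>
     u \<in> C1_L2 unit_square \<inter> L2_H2 unit_square \<and> f \<in> L2 unit_square \<and>
     (AE t in lebesgue_on {0<..<1}. AE p in lebesgue_on unit_square.
        time_deriv unit_square u t p - laplacian unit_square (u t) p = \<phi> t * f p) \<and>
     (AE t in lebesgue_on {0<..<1}.
        has_trace (\<lambda>y. (0, y)) (weak_deriv unit_square (1, 0) (u t)) (\<lambda>_. 0) \<and>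
        has_trace (\<lambda>y. (1, y)) (weak_deriv unit_square (1, 0) (u t)) (\<lambda>_. 0) \<and>
        has_trace (\<lambda>x. (x, 0)) (weak_deriv unit_square (0, 1) (u t)) (\<lambda>_. 0) \<and>
        has_trace (\<lambda>x. (x, 1)) (weak_deriv unit_square (0, 1) (u t)) (\<lambda>_. 0) \<and>
        has_trace (\<lambda>y. (1, y)) (u t) (\<lambda>_. 0)) \<and>
     (AE p in lebesgue_on unit_square. u 0 p = g0 p) \<and>
     (AE p in lebesgue_on unit_square. u 1 p = g1 p)"

end

theory Submission
  imports Defs "HOL-Complex_Analysis.Complex_Analysis"
begin

text \<open>
  Test the equation with the separated solutions \<open>exp (\<mu> t) * cosh (l x) * cos (n \<pi> y)\<close> of the
  adjoint equation, where \<open>\<mu> = n\<^sup>2 \<pi>\<^sup>2 - l\<^sup>2\<close>. Their normal derivative vanishes on all sides but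
  \<open>x = 1\<close>, where both Cauchy data of \<open>u\<close> vanish, so Green's formula has no boundary terms and
  the initial and final data determine \<open>\<Phi> \<mu> * (\<integral> f cosh (l x) cos (n \<pi> y))\<close> for every \<open>l\<close> and
  \<open>n\<close>, with \<open>\<Phi> \<mu> = \<integral> exp (\<mu> t) \<phi> t\<close>. Since \<open>\<Phi>\<close> is continuous and nonzero at some
  nonpositive \<open>\<mu>\<close>, the second factor is known for \<open>l\<close> in some interval, hence, being entire in
  \<open>l\<close>, so are its Taylor coefficients, the integrals of \<open>f x\<^bsup>2k\<^esup> cos (n \<pi> y)\<close>. By
  Stone--Weierstrass these determine \<open>f\<close>, and the same argument on \<open>[0, t]\<close> determines \<open>u t\<close>.
\<close>

subsection \<open>Square integrable functions\<close>

text \<open>The condition \<open>u = 0\<close> on the side \<open>x = 1\<close> is what frees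
  \<open>l\<close>. With Neumann data alone the usable test functions are the Neumann
  eigenfunctions, and at an eigenvalue where the transform of \<phi> vanishes the initial and final
  data say nothing about the corresponding component of \<open>f\<close>; nothing excludes this for
  a \<phi> that changes sign. Since nothing is demanded of the test function at
  \<open>x = 1\<close>, \<open>l\<close> varies over an interval and the zeros of the transform can
  be avoided. A nonpositive \<mu> is wanted because
  \<open>\<mu> = n\<^sup>2 \<pi>\<^sup>2 - l\<^sup>2\<close> must have a real solution
  \<open>l\<close> for every \<open>n\<close>, including \<open>n = 0\<close>. It is found among the
  numbers \<open>- k\<close> with \<open>k\<close> natural: otherwise \<phi> would be orthogonal to
  all powers of \<open>exp (- t)\<close>, hence zero. Two obstacles shape the details. A trace is
  known only through some approximating sequence of smooth functions, possibly a different one for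
  each side, so boundary terms are removed one side at a time. And \<open>weak_deriv\<close> is a
  choice of representative, so it has no algebraic laws of its own and every identity for it passes
  through uniqueness up to null sets.\<close>

lemma L2_measurable: "f \<in> L2 S \<Longrightarrow> f \<in> borel_measurable (lebesgue_on S)"
  by (simp add: L2_def)

lemma L2_power2_integrable: "f \<in> L2 S \<Longrightarrow> integrable (lebesgue_on S) (\<lambda>x. (f x)\<^sup>2)"
  by (simp add: L2_def)

lemma L2_mult_integrable:
  assumes "f \<in> L2 S" "g \<in> L2 S"
  shows "integrable (lebesgue_on S) (\<lambda>x. f x * g x)"
proof (rule Bochner_Integration.integrable_bound)
  show "integrable (lebesgue_on S) (\<lambda>x. (f x)\<^sup>2 + (g x)\<^sup>2)"
    using assms by (intro Bochner_Integration.integrable_add L2_power2_integrable)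
  show "(\<lambda>x. f x * g x) \<in> borel_measurable (lebesgue_on S)"
    using assms by (intro borel_measurable_times L2_measurable)
  have "\<bar>a * b\<bar> \<le> a\<^sup>2 + b\<^sup>2" for a b :: real
  proof -
    have "2 * (\<bar>a\<bar> * \<bar>b\<bar>) \<le> \<bar>a\<bar>\<^sup>2 + \<bar>b\<bar>\<^sup>2"
      using sum_squares_bound[of "\<bar>a\<bar>" "\<bar>b\<bar>"] by simp
    moreover have "0 \<le> \<bar>a\<bar> * \<bar>b\<bar>"
      by simp
    ultimately show ?thesis
      unfolding abs_mult power2_abs by linarith
  qed
  then show "AE x in lebesgue_on S. norm (f x * g x) \<le> norm ((f x)\<^sup>2 + (g x)\<^sup>2)"
    by simp
qed

lemma L2_add:
  assumes "f \<in> L2 S" "g \<in> L2 S"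
  shows "(\<lambda>x. f x + g x) \<in> L2 S"
proof -
  have "integrable (lebesgue_on S) (\<lambda>x. (f x)\<^sup>2 + (g x)\<^sup>2 + 2 * (f x * g x))"
    using assms by (intro Bochner_Integration.integrable_add L2_power2_integrable
        integrable_mult_right L2_mult_integrable)
  then have "integrable (lebesgue_on S) (\<lambda>x. (f x + g x)\<^sup>2)"
    by (simp add: power2_sum mult.assoc)
  then show ?thesis
    using assms by (auto simp: L2_def)
qed

lemma L2_cmult:
  assumes "f \<in> L2 S"
  shows "(\<lambda>x. c * f x) \<in> L2 S"
  using assms by (auto simp: L2_def power_mult_distrib)

lemma L2_diff:
  assumes "f \<in> L2 S" "g \<in> L2 S"
  shows "(\<lambda>x. f x - g x) \<in> L2 S"
  using L2_add[OF assms(1) L2_cmult[OF assms(2), of "-1"]] by simp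

lemma L2_norm_nonneg: "0 \<le> L2_norm S f"
  by (simp add: L2_norm_def)

lemma L2_norm_cong_AE:
  assumes "f \<in> borel_measurable (lebesgue_on S)" "g \<in> borel_measurable (lebesgue_on S)"
    and "AE x in lebesgue_on S. f x = g x"
  shows "L2_norm S f = L2_norm S g"
proof -
  have "(LINT x|lebesgue_on S. (f x)\<^sup>2) = (LINT x|lebesgue_on S. (g x)\<^sup>2)"
    using assms by (intro integral_cong_AE) auto
  then show ?thesis
    by (simp add: L2_norm_def)
qed

lemma L2_Cauchy_Schwarz:
  assumes f: "f \<in> L2 S" and g: "g \<in> L2 S"
  shows "\<bar>LINT x|lebesgue_on S. f x * g x\<bar> \<le> L2_norm S f * L2_norm S g"
proof -
  define a b c where "a = (LINT x|lebesgue_on S. (f x)\<^sup>2)"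
    and "b = (LINT x|lebesgue_on S. f x * g x)" and "c = (LINT x|lebesgue_on S. (g x)\<^sup>2)"
  have quad: "0 \<le> s\<^sup>2 * a + 2 * s * t * b + t\<^sup>2 * c" for s t
  proof -
    have "(LINT x|lebesgue_on S. (s * f x + t * g x)\<^sup>2)
      = (LINT x|lebesgue_on S. s\<^sup>2 * (f x)\<^sup>2 + (2 * s * t) * (f x * g x) + t\<^sup>2 * (g x)\<^sup>2)"
      by (intro Bochner_Integration.integral_cong) (auto simp: power2_eq_square algebra_simps)
    also have "\<dots> = s\<^sup>2 * a + 2 * s * t * b + t\<^sup>2 * c"
      unfolding a_def b_def c_def
      by (simp add: L2_power2_integrable[OF f] L2_power2_integrable[OF g] L2_mult_integrable[OF f g])
    moreover have "0 \<le> (LINT x|lebesgue_on S. (s * f x + t * g x)\<^sup>2)"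
      by simp
    ultimately show ?thesis
      by simp
  qed
  have "0 \<le> a" "0 \<le> c"
    by (simp_all add: a_def c_def)
  have "b\<^sup>2 \<le> a * c"
  proof (cases "c = 0")
    case True
    have "b = 0"
    proof (rule ccontr)
      assume "b \<noteq> 0"
      \<comment> \<open>With \<open>c = 0\<close> the form is affine in its second variable; this
        argument gives it the value \<open>- a - 2 < 0\<close>.\<close>
      have "0 \<le> 1 * a + 2 * 1 * (- (a + 1) / b) * b + (- (a + 1) / b)\<^sup>2 * c"
        using quad[of 1 "- (a + 1) / b"] by simp
      moreover have "2 * 1 * (- (a + 1) / b) * b = - 2 * (a + 1)"
        using \<open>b \<noteq> 0\<close> by simp
      ultimately show False
        using True \<open>0 \<le> a\<close> by simp
    qed
    then show ?thesis
      using True by simp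
  next
    case False
    then have "c > 0"
      using \<open>0 \<le> c\<close> by simp
    \<comment> \<open>The minimum of the quadratic form along rays: \<open>s : t = c : - b\<close>,
      scaled to avoid division.\<close>
    have "0 \<le> c\<^sup>2 * a + 2 * c * (-b) * b + (-b)\<^sup>2 * c"
      by (rule quad)
    also have "\<dots> = c * (a * c - b\<^sup>2)"
      by (simp add: power2_eq_square algebra_simps)
    finally show ?thesis
      using \<open>c > 0\<close> by (simp add: zero_le_mult_iff)
  qed
  then have "sqrt (b\<^sup>2) \<le> sqrt (a * c)"
    by (rule real_sqrt_le_mono)
  then show ?thesis
    by (simp add: L2_norm_def a_def b_def c_def real_sqrt_mult)
qed

text \<open>Cauchy--Schwarz: norm convergence implies weak convergence. The filter is arbitrary
  because the lemma serves both sequences of smooth approximations and difference quotients in time;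
  the latter lie in \<open>L2\<close> only eventually.\<close>

lemma L2_inner_tendsto:
  assumes F: "\<forall>\<^sub>F n in A. F n \<in> L2 S" and f: "f \<in> L2 S" and g: "g \<in> L2 S"
    and lim: "((\<lambda>n. L2_norm S (\<lambda>x. F n x - f x)) \<longlongrightarrow> 0) A"
  shows "((\<lambda>n. LINT x|lebesgue_on S. F n x * g x) \<longlongrightarrow> (LINT x|lebesgue_on S. f x * g x)) A"
proof (rule Lim_transform)
  show "((\<lambda>n. LINT x|lebesgue_on S. f x * g x) \<longlongrightarrow> (LINT x|lebesgue_on S. f x * g x)) A"
    by simp
  have "\<forall>\<^sub>F n in A. norm ((LINT x|lebesgue_on S. F n x * g x) - (LINT x|lebesgue_on S. f x * g x))
    \<le> L2_norm S (\<lambda>x. F n x - f x) * L2_norm S g"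
    using F
  proof eventually_elim
    case (elim n)
    have "(LINT x|lebesgue_on S. F n x * g x) - (LINT x|lebesgue_on S. f x * g x)
      = (LINT x|lebesgue_on S. (F n x - f x) * g x)"
      using elim f g by (simp add: left_diff_distrib L2_mult_integrable)
    then show ?case
      using L2_Cauchy_Schwarz[OF L2_diff[OF elim f] g] by simp
  qed
  moreover have "((\<lambda>n. L2_norm S (\<lambda>x. F n x - f x) * L2_norm S g) \<longlongrightarrow> 0) A"
    using tendsto_mult_left_zero[OF lim] .
  ultimately show "((\<lambda>n. (LINT x|lebesgue_on S. F n x * g x) - (LINT x|lebesgue_on S. f x * g x)) \<longlongrightarrow> 0) A"
    by (rule Lim_null_comparison)
qed

lemma L2_continuous_box:
  fixes f :: "'a::euclidean_space \<Rightarrow> real"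
  assumes "continuous_on (cbox a b) f"
  shows "f \<in> L2 (box a b)"
proof -
  have "integrable (lebesgue_on (cbox a b)) (\<lambda>x. (f x)\<^sup>2)"
    using assms by (intro continuous_imp_integrable continuous_intros)
  then have "integrable (lebesgue_on (box a b)) (\<lambda>x. (f x)\<^sup>2)"
    using set_integrable_subset[of lebesgue "cbox a b" "\<lambda>x. (f x)\<^sup>2" "box a b"]
    by (simp add: integrable_restrict_space set_integrable_def box_subset_cbox)
  then show ?thesis
    using assms continuous_on_subset[OF assms box_subset_cbox]
    by (auto simp: L2_def intro!: continuous_imp_measurable_on_sets_lebesgue)
qed

subsection \<open>Functions with vanishing integrals\<close>

text \<open>Open boxes are an intersection-stable generator of the Borel sets, and the sets over
  which \<open>f\<close> integrates to zero form a Dynkin system. Lebesgue sets differ from Borel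
  sets by null sets only, so \<open>f\<close> and 0 have the same integral over every measurable
  set.\<close>

lemma AE_zero_if_integral_box_zero:
  fixes f :: "'a::euclidean_space \<Rightarrow> real"
  assumes S: "S \<in> sets lebesgue" and f: "integrable (lebesgue_on S) f"
    and box: "\<And>a b. (LINT x|lebesgue_on S. indicator (box a b) x * f x) = 0"
  shows "AE x in lebesgue_on S. f x = 0"
proof -
  let ?M = "lebesgue_on S"
  have borel_sets: "A \<inter> S \<in> sets ?M" if "A \<in> sets borel" for A
    using that S by (auto simp: sets_restrict_space)
  have meas: "indicat_real A \<in> borel_measurable ?M" if "A \<in> sets borel" for A
    using borel_sets[OF that] S by (subst borel_measurable_indicator_iff) simp
  have int: "integrable ?M (\<lambda>x. indicator A x * f x)" if "A \<in> sets borel" for A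
  proof (rule Bochner_Integration.integrable_bound[OF f])
    show "(\<lambda>x. indicat_real A x * f x) \<in> borel_measurable ?M"
      using borel_measurable_times[OF meas[OF that] borel_measurable_integrable[OF f]] .
  qed (auto simp: indicator_def)
  \<comment> \<open>The complement step of the Dynkin argument needs the integral over the whole
    space, which is exhausted by growing boxes.\<close>
  have total: "(LINT x|?M. f x) = 0"
  proof (rule LIMSEQ_unique)
    let ?B = "\<lambda>n::nat. box (- (real n *\<^sub>R One)) (real n *\<^sub>R One) :: 'a set"
    show "(\<lambda>n. LINT x|?M. indicator (?B n) x * f x) \<longlonglongrightarrow> (LINT x|?M. f x)"
    proof (rule integral_dominated_convergence[where w = "\<lambda>x. norm (f x)"])
      show "AE x in ?M. (\<lambda>n. indicator (?B n) x * f x) \<longlonglongrightarrow> f x"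
      proof (rule AE_I2)
        fix x :: 'a
        obtain N :: nat where N: "norm x < real N"
          using reals_Archimedean2 by blast
        have "x \<in> ?B n" if "n \<ge> N" for n
        proof -
          have "\<bar>x \<bullet> i\<bar> < real n" if "i \<in> Basis" for i
            using Basis_le_norm[OF that, of x] N \<open>n \<ge> N\<close> by linarith
          then show ?thesis
            by (auto simp: mem_box inner_minus_left abs_less_iff minus_less_iff)
        qed
        then have "\<forall>\<^sub>F n in sequentially. indicator (?B n) x * f x = f x"
          unfolding eventually_sequentially by (metis indicator_simps(1) mult_1)
        then show "(\<lambda>n. indicator (?B n) x * f x) \<longlonglongrightarrow> f x"
          by (rule tendsto_eventually)
      qed
      show "(\<lambda>x. indicator (?B n) x * f x) \<in> borel_measurable ?M" for n
        using int[of "?B n"] by auto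
    qed (use f in \<open>auto simp: indicator_def\<close>)
    show "(\<lambda>n. LINT x|?M. indicator (?B n) x * f x) \<longlonglongrightarrow> 0"
      by (simp add: box)
  qed
  have borel: "(LINT x|?M. indicator A x * f x) = 0" if "A \<in> sets borel" for A
  proof -
    have "Int_stable (range (\<lambda>(a, b). box a b :: 'a set))"
      by (auto simp: Int_stable_def box_Int_box)
    moreover have "range (\<lambda>(a, b). box a b :: 'a set) \<subseteq> Pow UNIV"
      by simp
    moreover have "A \<in> sigma_sets UNIV (range (\<lambda>(a, b). box a b :: 'a set))"
      using that by (simp add: borel_eq_box)
    ultimately show ?thesis
    proof (induction rule: sigma_sets_induct_disjoint)
      case (basic A)
      then show ?case using box by auto
    next
      case empty
      then show ?case by simp
    next
      case (compl A)
      then have "A \<in> sets borel"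
        by (simp add: borel_eq_box)
      have "(LINT x|?M. indicator (UNIV - A) x * f x) = (LINT x|?M. f x - indicator A x * f x)"
        by (intro Bochner_Integration.integral_cong) (auto simp: indicator_def)
      then show ?case
        using compl total f int[OF \<open>A \<in> sets borel\<close>] by simp
    next
      case (union A)
      have A: "A i \<in> sets borel" for i
        using union by (auto simp: borel_eq_box)
      have "(\<lambda>i. LINT x|?M. indicator (A i) x * f x) sums 
        (LINT x|?M. indicator (\<Union>i. A i) x * f x)"
      proof -
        have "(\<lambda>n. LINT x|?M. (\<Sum>i<n. indicator (A i) x * f x)) \<longlonglongrightarrow> (LINT x|?M. indicator (\<Union>i. A i) x * f x)"
        proof (rule integral_dominated_convergence[where w = "\<lambda>x. norm (f x)"])
          show "AE x in ?M. (\<lambda>n. \<Sum>i<n. indicator (A i) x * f x) \<longlonglongrightarrow> indicator (\<Union>i. A i) x * f x"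
          proof (rule AE_I2)
            fix x
            have "(\<lambda>i. indicat_real (A i) x) sums indicator (\<Union>i. A i) x"
              using union(1) by (intro indicator_sums) (auto simp: disjoint_family_on_def)
            from sums_mult2[OF this, of "f x"]
            show "(\<lambda>n. \<Sum>i<n. indicator (A i) x * f x) \<longlonglongrightarrow> indicator (\<Union>i. A i) x * f x"
              by (simp add: sums_def)
          qed
          show "AE x in ?M. norm (\<Sum>i<n. indicator (A i) x * f x) \<le> norm (f x)" for n
          proof (rule AE_I2)
            fix x
            have "(\<Sum>i<n. indicator (A i) x * f x) = indicator (\<Union>i<n. A i) x * f x"
              using union(1) 
              by (subst indicator_UN_disjoint) (auto simp: sum_distrib_right disjoint_family_on_def)
            then show "norm (\<Sum>i<n. indicator (A i) x * f x) \<le> norm (f x)"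
              by (auto simp: indicator_def)
          qed
          show "(\<lambda>x. indicator (\<Union>i. A i) x * f x) \<in> borel_measurable ?M"
            using A by (intro borel_measurable_integrable int) auto
          show "(\<lambda>x. \<Sum>i<n. indicator (A i) x * f x) \<in> borel_measurable ?M" for n
            by (intro borel_measurable_sum borel_measurable_integrable int A)
        qed (use f in simp)
        then show ?thesis
          unfolding sums_def by (subst (asm) Bochner_Integration.integral_sum) (auto intro: int A)
      qed
      then have "(\<lambda>i. 0) sums (LINT x|?M. indicator (\<Union>i. A i) x * f x)"
        using union(3) by simp
      then show ?case
        using sums_unique2[OF sums_zero] by metis
    qed
  qed
  show ?thesis
  proof (rule density_unique_real)
    fix A assume "A \<in> sets ?M"
    then obtain A' where A': "A' \<in> sets lebesgue" "A = A' \<inter> S"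
      by (auto simp: sets_restrict_space)
    \<comment> \<open>Splitting off a part of a null set leaves the Borel set
      \<open>B\<close>.\<close>
    obtain B N N' where BN: "A' = B \<union> N" "N \<subseteq> N'" "N' \<in> null_sets lborel" "B \<in> sets lborel"
      using sets_completionE[OF A'(1)] by metis
    have "AE x in lebesgue. x \<notin> N'"
      using BN(3) AE_completion AE_not_in by blast
    then have "AE x in ?M. x \<notin> N'"
      using S by (auto simp: AE_restrict_space_iff elim: eventually_mono)
    then have "AE x in ?M. indicator A x * f x = indicator B x * f x"
    proof (rule AE_mp)
      show "AE x in ?M. x \<notin> N' \<longrightarrow> indicator A x * f x = indicator B x * f x"
      proof (intro AE_I2 impI)
        fix x assume "x \<in> space ?M" "x \<notin> N'"
        then have "x \<in> A \<longleftrightarrow> x \<in> B"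
          using BN A' by auto
        then show "indicator A x * f x = indicator B x * f x"
          by (simp add: indicator_def)
      qed
    qed
    then have "(LINT x|?M. indicator A x * f x) = (LINT x|?M. indicator B x * f x)"
    proof (rule integral_cong_AE[rotated 2])
      show "(\<lambda>x. indicat_real A x * f x) \<in> borel_measurable ?M"
        using borel_measurable_times[OF borel_measurable_indicator[OF \<open>A \<in> sets ?M\<close>] borel_measurable_integrable[OF f]] .
      show "(\<lambda>x. indicat_real B x * f x) \<in> borel_measurable ?M"
        using BN by (intro borel_measurable_integrable int) simp
    qed
    then show "(LINT x:A|?M. f x) = (LINT x:A|?M. 0)"
      using borel BN by (simp add: set_lebesgue_integral_def)
  qed (simp_all add: f)
qed

text \<open>By Stone--Weierstrass the algebra \<open>P\<close> is uniformly dense in the continuous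
  functions on \<open>K\<close>, and an approximation within \<open>e\<close> changes the integral
  by at most \<open>e\<close> times the integral of \<open>\<bar>f\<bar>\<close>. The compact
  \<open>K\<close> is separate from \<open>S\<close>, which will be an open square or
  interval.\<close>

lemma integral_mult_continuous_zero:
  fixes f :: "'a::euclidean_space \<Rightarrow> real"
  assumes S: "S \<in> sets lebesgue" "S \<subseteq> K" "compact K" and f: "integrable (lebesgue_on S) f"
    and const: "\<And>c. P (\<lambda>x. c)" and cont: "\<And>g. P g \<Longrightarrow> continuous_on K g"
    and add: "\<And>g h. P g \<Longrightarrow> P h \<Longrightarrow> P (\<lambda>x. g x + h x)"
    and mult: "\<And>g h. P g \<Longrightarrow> P h \<Longrightarrow> P (\<lambda>x. g x * h x)"
    and sep: "\<And>x y. x \<in> K \<Longrightarrow> y \<in> K \<Longrightarrow> x \<noteq> y \<Longrightarrow> \<exists>g. P g \<and> g x \<noteq> g y"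
    and zero: "\<And>g. P g \<Longrightarrow> (LINT x|lebesgue_on S. f x * g x) = 0"
    and g: "continuous_on K g"
  shows "(LINT x|lebesgue_on S. f x * g x) = 0"
proof -
  have int: "integrable (lebesgue_on S) (\<lambda>x. f x * h x)" if h: "continuous_on K h" for h
  proof -
    obtain B where B: "\<And>x. x \<in> K \<Longrightarrow> \<bar>h x\<bar> \<le> B"
      using compact_imp_bounded[OF compact_continuous_image[OF h S(3)]]
      by (auto simp: bounded_iff)
    show ?thesis
    proof (rule Bochner_Integration.integrable_bound[where f = "\<lambda>x. B * f x"])
      have "h \<in> borel_measurable (lebesgue_on S)"
        using continuous_on_subset[OF h S(2)] S(1) by (rule continuous_imp_measurable_on_sets_lebesgue)
      then show "(\<lambda>x. f x * h x) \<in> borel_measurable (lebesgue_on S)"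
        using f by auto
      show "AE x in lebesgue_on S. norm (f x * h x) \<le> norm (B * f x)"
      proof (rule AE_I2)
        fix x assume "x \<in> space (lebesgue_on S)"
        then have "\<bar>h x\<bar> \<le> \<bar>B\<bar>"
          using B[of x] S by auto
        then show "norm (f x * h x) \<le> norm (B * f x)"
          using mult_right_mono[of "\<bar>h x\<bar>" "\<bar>B\<bar>" "\<bar>f x\<bar>"] by (simp add: abs_mult mult.commute)
      qed
    qed (use f in simp)
  qed
  let ?I = "LINT x|lebesgue_on S. \<bar>f x\<bar>"
  have "\<bar>LINT x|lebesgue_on S. f x * g x\<bar> \<le> e * ?I" if "e > 0" for e
  proof -
    have "\<exists>h. P h \<and> (\<forall>x\<in>K. \<bar>g x - h x\<bar> < e)"
    proof (rule Stone_Weierstrass_HOL)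
      show "P (\<lambda>x. f x + h x)" if "P f \<and> P h" for f h
        using add that by simp
      show "P (\<lambda>x. f x * h x)" if "P f \<and> P h" for f h
        using mult that by simp
      show "\<exists>f. P f \<and> f x \<noteq> f y" if "x \<in> K \<and> y \<in> K \<and> x \<noteq> y" for x y
        using sep that by simp
    qed (fact S(3) const cont g \<open>e > 0\<close>)+
    then obtain h where h: "P h" "\<And>x. x \<in> K \<Longrightarrow> \<bar>g x - h x\<bar> < e"
      by auto
    have "(LINT x|lebesgue_on S. f x * g x) = (LINT x|lebesgue_on S. f x * g x) - (LINT x|lebesgue_on S. f x * h x)"
      using zero[OF h(1)] by simp
    also have "\<dots> = (LINT x|lebesgue_on S. f x * g x - f x * h x)"
      using int[OF g] int[OF cont[OF h(1)]] by simp
    also have "\<bar>\<dots>\<bar> \<le> (LINT x|lebesgue_on S. \<bar>f x * g x - f x * h x\<bar>)"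
      by (rule integral_abs_bound)
    also have "\<dots> \<le> (LINT x|lebesgue_on S. e * \<bar>f x\<bar>)"
    proof (rule integral_mono)
      fix x assume "x \<in> space (lebesgue_on S)"
      then have "\<bar>g x - h x\<bar> \<le> e"
        using h(2)[of x] S by auto
      then have "\<bar>f x\<bar> * \<bar>g x - h x\<bar> \<le> \<bar>f x\<bar> * e"
        by (simp add: mult_left_mono)
      then show "\<bar>f x * g x - f x * h x\<bar> \<le> e * \<bar>f x\<bar>"
        by (simp add: mult.commute flip: abs_mult right_diff_distrib)
    qed (use f int[OF g] int[OF cont[OF h(1)]] in auto)
    finally show ?thesis
      by simp
  qed
  then have bd: "\<bar>LINT x|lebesgue_on S. f x * g x\<bar> \<le> e * ?I" if "e > 0" for e
    using that by blast
  have "0 \<le> ?I" by simp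
  show ?thesis
  proof (rule ccontr)
    assume nz: "(LINT x|lebesgue_on S. f x * g x) \<noteq> 0"
    let ?J = "\<bar>LINT x|lebesgue_on S. f x * g x\<bar>"
    \<comment> \<open>This \<open>e\<close> gives \<open>?J \<le> ?J / 2\<close>; the added 1 keeps
      the denominator positive when \<open>?I = 0\<close>.\<close>
    have "?J \<le> ?J / (2 * (?I + 1)) * ?I"
      using nz \<open>0 \<le> ?I\<close> by (intro bd divide_pos_pos mult_pos_pos add_nonneg_pos) simp_all
    also have "\<dots> \<le> ?J / 2"
    proof -
      have "j / (2 * (i + 1)) * i \<le> j / 2" if "0 \<le> i" "0 \<le> j" for i j :: real
      proof -
        have "j / 2 * (i / (i + 1)) \<le> j / 2 * 1"
          using that by (intro mult_left_mono) auto
        then show ?thesis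
          by simp
      qed
      then show ?thesis
        using \<open>0 \<le> ?I\<close> by simp
    qed
    finally show False
      using nz by simp
  qed
qed

subsection \<open>Smooth bump functions\<close>

lemma poly_mult_exp_tendsto_0:
  fixes P :: "real poly"
  assumes "c > 0"
  shows "((\<lambda>y. poly P y * exp (- (c * y))) \<longlongrightarrow> 0) at_top"
proof -
  have "((\<lambda>y. y ^ i * exp (- (c * y))) \<longlongrightarrow> 0) at_top" for i
  proof -
    have "((\<lambda>y. (c * y) ^ i / exp (c * y)) \<longlongrightarrow> 0) at_top"
      using assms
      by (intro filterlim_compose[OF tendsto_power_div_exp_0] filterlim_tendsto_pos_mult_at_top[OF tendsto_const])
        (auto intro: filterlim_ident)
    then have "((\<lambda>y. (1 / c ^ i) * ((c * y) ^ i / exp (c * y))) \<longlongrightarrow> 0) at_top"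
      by (rule tendsto_mult_right_zero)
    then show ?thesis
      using assms by (simp add: power_mult_distrib exp_minus field_simps)
  qed
  then have "((\<lambda>y. \<Sum>i\<le>degree P. coeff P i * (y ^ i * exp (- (c * y)))) \<longlongrightarrow> (\<Sum>i\<le>degree P. coeff P i * 0)) at_top"
    by (intro tendsto_intros)
  then show ?thesis
    by (simp add: poly_altdef sum_distrib_right mult.assoc)
qed

text \<open>The classical smooth function \<open>exp (- c / x)\<close>, extended by 0. The
  polynomial in \<open>1 / x\<close> makes the family closed under differentiation; \<open>c\<close>
  is a parameter because the indicator of the positive half-line arises as \<open>c\<close> tends to
  0.\<close>

definition flat :: "real \<Rightarrow> real poly \<Rightarrow> real \<Rightarrow> real" where
  "flat c P x = (if 0 < x then poly P (1 / x) * exp (- (c / x)) else 0)"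

text \<open>In terms of \<open>y = 1 / x\<close>, differentiation multiplies by
  \<open>- y\<^sup>2\<close> and differentiates in \<open>y\<close>, which turns
  \<open>P y * exp (- c y)\<close> into \<open>y\<^sup>2 (c P - P') y * exp (- c y)\<close>;
  \<open>[:0, 0, 1:]\<close> is the factor \<open>y\<^sup>2\<close>. At 0 exponential decay beats
  every polynomial.\<close>

lemma flat_deriv:
  assumes "c > 0"
  shows "(flat c P has_real_derivative flat c ([:0, 0, 1:] * (smult c P - pderiv P)) x) (at x)"
proof -
  let ?Q = "[:0, 0, 1:] * (smult c P - pderiv P)"
  consider "x > 0" | "x < 0" | "x = 0"
    by linarith
  then show ?thesis
  proof cases
    case 1
    have "((\<lambda>x. poly P (1 / x) * exp (- (c / x))) has_real_derivative
        poly P (1 / x) * (exp (- (c / x)) * (c / x\<^sup>2)) + poly (pderiv P) (1 / x) * (- 1 / x\<^sup>2) * exp (- (c / x))) (at x)"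
      using 1 by (auto intro!: derivative_eq_intros simp: power2_eq_square field_simps)
    moreover have "poly P (1 / x) * (exp (- (c / x)) * (c / x\<^sup>2)) + poly (pderiv P) (1 / x) * (- 1 / x\<^sup>2) * exp (- (c / x))
        = flat c ?Q x"
      using 1 by (simp add: flat_def field_simps power2_eq_square)
    ultimately have "((\<lambda>x. poly P (1 / x) * exp (- (c / x))) has_real_derivative flat c ?Q x) (at x)"
      by simp
    then show ?thesis
      by (rule has_field_derivative_transform_within[where d = x]) (use 1 in \<open>auto simp: flat_def dist_real_def\<close>)
  next
    case 2
    have "((\<lambda>x. 0) has_real_derivative flat c ?Q x) (at x)"
      using 2 by (simp add: flat_def)
    then show ?thesis
      by (rule has_field_derivative_transform_within[where d = "-x"]) (use 2 in \<open>auto simp: flat_def dist_real_def\<close>)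
  next
    case 3
    \<comment> \<open>\<open>pCons 0 P\<close> is \<open>y * P y\<close>: the extra factor
      \<open>y = 1 / h\<close> is the division in the difference quotient at 0.\<close>
    have "((\<lambda>x. poly (pCons 0 P) (inverse x) * exp (- (c * inverse x))) \<longlongrightarrow> 0) (at_right 0)"
      by (intro filterlim_compose[OF poly_mult_exp_tendsto_0[OF assms]] filterlim_inverse_at_top_right)
    then have "((\<lambda>h. flat c P h / h) \<longlongrightarrow> 0) (at_right 0)"
      by (rule Lim_transform_eventually)
        (auto simp: eventually_at_right_less flat_def field_simps intro!: eventually_at_rightI[of 0 1])
    moreover have "((\<lambda>h. flat c P h / h) \<longlongrightarrow> 0) (at_left 0)"
      by (rule tendsto_eventually) (auto simp: flat_def intro!: eventually_at_leftI[of "-1"])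
    ultimately have "((\<lambda>h. flat c P h / h) \<longlongrightarrow> 0) (at 0)"
      by (simp add: filterlim_split_at)
    then show ?thesis
      using 3 by (simp add: DERIV_def flat_def)
  qed
qed

lemma flat_one_bounds: "c > 0 \<Longrightarrow> 0 \<le> flat c 1 x \<and> flat c 1 x \<le> 1"
  by (auto simp: flat_def)

text \<open>Two limits at once: the vanishing parameter raises the function to 1, and the shift
  keeps its support at a positive distance from 0. The shift is what later makes supports compact
  inside the open square.\<close>

lemma flat_one_tendsto_indicator:
  "(\<lambda>n. flat (1 / Suc n) 1 (x - 1 / Suc n)) \<longlonglongrightarrow> indicator {0<..} x"
proof (cases "x > 0")
  case True
  have "(\<lambda>n. exp (- ((1 / Suc n) / (x - 1 / Suc n)))) \<longlonglongrightarrow> exp (- (0 / (x - 0)))"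
    using True by (intro tendsto_intros LIMSEQ_Suc[OF lim_1_over_n]) auto
  moreover have "\<forall>\<^sub>F n in sequentially. 1 / Suc n < x"
    using order_tendstoD(2)[OF LIMSEQ_Suc[OF lim_1_over_n] True] by simp
  then have "\<forall>\<^sub>F n in sequentially. exp (- ((1 / Suc n) / (x - 1 / Suc n))) = flat (1 / Suc n) 1 (x - 1 / Suc n)"
    by eventually_elim (simp add: flat_def)
  ultimately have "(\<lambda>n. flat (1 / Suc n) 1 (x - 1 / Suc n)) \<longlonglongrightarrow> exp (- (0 / (x - 0)))"
    by (rule Lim_transform_eventually)
  then show ?thesis
    using True by simp
next
  case False
  have "flat (1 / Suc n) 1 (x - 1 / Suc n) = 0" for n
  proof -
    have "0 < 1 / real (Suc n)"
      by simp
    then have "\<not> 0 < x - 1 / Suc n"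
      using False by linarith
    then show ?thesis
      by (simp only: flat_def if_False)
  qed
  then show ?thesis
    using False by simp
qed

section \<open>Smooth functions of two variables and products of flat functions\<close>

lemma has_derivative_imp_partial_deriv:
  assumes "(h has_derivative D) (at p)"
  shows "partial_deriv e h p = D e"
  using frechet_derivative_at[OF assms] by (simp add: partial_deriv_def)

text \<open>Induction on the order of differentiability. A family closed under both partial
  derivatives replaces explicit formulas for the higher derivatives.\<close>

lemma smoothI:
  assumes "h \<in> F"
    and F: "\<And>h p. h \<in> F \<Longrightarrow> h differentiable (at p)"
      "\<And>h. h \<in> F \<Longrightarrow> partial_deriv (1, 0) h \<in> F" "\<And>h. h \<in> F \<Longrightarrow> partial_deriv (0, 1) h \<in> F"
  shows "smooth h"
proof -
  have "C_k k h" if "h \<in> F" for k h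
    using that
  proof (induction k arbitrary: h)
    case 0
    then show ?case
      using F(1) by (auto intro!: continuous_at_imp_continuous_on differentiable_imp_continuous_within)
  next
    case (Suc k)
    then show ?case
      using F by auto
  qed
  then show ?thesis
    using assms by (auto simp: smooth_def)
qed

text \<open>The span of the products below is closed under partial derivatives.\<close>

inductive_set bumps :: "real \<Rightarrow> real \<times> real \<Rightarrow> real \<times> real \<Rightarrow> (real \<times> real \<Rightarrow> real) set"
  for c a b where
  prod: "(\<lambda>p. flat c P1 (fst p - fst a) * flat c P2 (fst b - fst p) *
      (flat c P3 (snd p - snd a) * flat c P4 (snd b - snd p))) \<in> bumps c a b"
| add: "f \<in> bumps c a b \<Longrightarrow> g \<in> bumps c a b \<Longrightarrow> (\<lambda>p. f p + g p) \<in> bumps c a b"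

lemma flat_minus: "- flat c P x = flat c (- P) x"
  by (simp add: flat_def)

lemma has_derivative_bumps:
  assumes "c > 0" "h \<in> bumps c a b"
  shows "\<exists>h1\<in>bumps c a b. \<exists>h2\<in>bumps c a b.
    \<forall>p. (h has_derivative (\<lambda>d. h1 p * fst d + h2 p * snd d)) (at p)"
  using assms(2)
proof induction
  case (prod P1 P2 P3 P4)
  define D' where "D' P = [:0, 0, 1:] * (smult c P - pderiv P)" for P
  let ?h = "\<lambda>P1 P2 P3 P4 p. flat c P1 (fst p - fst a) * flat c P2 (fst b - fst p) *
      (flat c P3 (snd p - snd a) * flat c P4 (snd b - snd p))"
  have D: "((\<lambda>p. flat c P (l p)) has_derivative (\<lambda>d. flat c (D' P) (l p) * l' d)) (at p)"
    if "(l has_derivative l') (at p)" for l :: "real \<times> real \<Rightarrow> real" and l' P p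
    using has_derivative_compose[OF that flat_deriv[OF assms(1), folded D'_def, unfolded has_field_derivative_def]]
    by (simp add: mult.commute)
  have D1: "((\<lambda>p. flat c P (fst p - fst a)) has_derivative (\<lambda>d. flat c (D' P) (fst p - fst a) * fst d)) (at p)" for P and p :: "real \<times> real"
    by (rule D[of "\<lambda>p. fst p - fst a" "fst"]) (auto intro!: derivative_eq_intros)
  \<comment> \<open>The sign from the reflected argument is absorbed into the polynomial, so the
    derivative is again a product of the required shape.\<close>
  have D2: "((\<lambda>p. flat c P (fst b - fst p)) has_derivative (\<lambda>d. flat c (- D' P) (fst b - fst p) * fst d)) (at p)" for P and p :: "real \<times> real"
  proof -
    have "((\<lambda>p. flat c P (fst b - fst p)) has_derivative (\<lambda>d. flat c (D' P) (fst b - fst p) * (- fst d))) (at p)"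
      by (rule D[of "\<lambda>p. fst b - fst p" "\<lambda>d. - fst d"]) (auto intro!: derivative_eq_intros)
    then show ?thesis
      by (simp add: flat_minus[symmetric])
  qed
  have D3: "((\<lambda>p. flat c P (snd p - snd a)) has_derivative (\<lambda>d. flat c (D' P) (snd p - snd a) * snd d)) (at p)" for P and p :: "real \<times> real"
    by (rule D[of "\<lambda>p. snd p - snd a" "snd"]) (auto intro!: derivative_eq_intros)
  have D4: "((\<lambda>p. flat c P (snd b - snd p)) has_derivative (\<lambda>d. flat c (- D' P) (snd b - snd p) * snd d)) (at p)" for P and p :: "real \<times> real"
  proof -
    have "((\<lambda>p. flat c P (snd b - snd p)) has_derivative (\<lambda>d. flat c (D' P) (snd b - snd p) * (- snd d))) (at p)"
      by (rule D[of "\<lambda>p. snd b - snd p" "\<lambda>d. - snd d"]) (auto intro!: derivative_eq_intros)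
    then show ?thesis
      by (simp add: flat_minus[symmetric])
  qed
  define h1 where "h1 = (\<lambda>p. ?h (D' P1) P2 P3 P4 p + ?h P1 (- D' P2) P3 P4 p)"
  define h2 where "h2 = (\<lambda>p. ?h P1 P2 (D' P3) P4 p + ?h P1 P2 P3 (- D' P4) p)"
  have "(?h P1 P2 P3 P4 has_derivative (\<lambda>d. h1 p * fst d + h2 p * snd d)) (at p)" for p
    unfolding h1_def h2_def
    using has_derivative_mult[OF has_derivative_mult[OF D1[of P1 p] D2[of P2 p]] has_derivative_mult[OF D3[of P3 p] D4[of P4 p]]]
    by (rule has_derivative_eq_rhs) (rule ext, simp only: distrib_left distrib_right mult_ac add_ac)
  moreover have "h1 \<in> bumps c a b" "h2 \<in> bumps c a b"
    unfolding h1_def h2_def by (rule bumps.add; rule bumps.prod)+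
  ultimately show ?case
    by blast
next
  case (add f g)
  obtain f1 f2 where f12: "f1 \<in> bumps c a b" "f2 \<in> bumps c a b"
    and f: "\<And>p. (f has_derivative (\<lambda>d. f1 p * fst d + f2 p * snd d)) (at p)"
    using add.IH(1) by blast
  obtain g1 g2 where g12: "g1 \<in> bumps c a b" "g2 \<in> bumps c a b"
    and g: "\<And>p. (g has_derivative (\<lambda>d. g1 p * fst d + g2 p * snd d)) (at p)"
    using add.IH(2) by blast
  define h1 h2 where "h1 = (\<lambda>p. f1 p + g1 p)" and "h2 = (\<lambda>p. f2 p + g2 p)"
  have "((\<lambda>p. f p + g p) has_derivative (\<lambda>d. h1 p * fst d + h2 p * snd d)) (at p)" for p
    by (rule has_derivative_eq_rhs[OF has_derivative_add[OF f g]])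
      (simp add: fun_eq_iff h1_def h2_def algebra_simps)
  moreover have "h1 \<in> bumps c a b" "h2 \<in> bumps c a b"
    unfolding h1_def h2_def using f12 g12 by (auto intro: bumps.add)
  ultimately show ?case
    by blast
qed

lemma smooth_bumps:
  assumes "c > 0" "h \<in> bumps c a b"
  shows "smooth h"
proof (rule smoothI[OF assms(2)])
  fix h assume "h \<in> bumps c a b"
  then obtain h1 h2 where h: "h1 \<in> bumps c a b" "h2 \<in> bumps c a b"
    and D: "\<And>p. (h has_derivative (\<lambda>d. h1 p * fst d + h2 p * snd d)) (at p)"
    using has_derivative_bumps[OF assms(1)] by blast
  show "h differentiable (at p)" for p
    using D unfolding differentiable_def by blast
  have "partial_deriv (1, 0) h = h1" "partial_deriv (0, 1) h = h2"
    using has_derivative_imp_partial_deriv[OF D] by (simp_all add: fun_eq_iff)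
  then show "partial_deriv (1, 0) h \<in> bumps c a b" "partial_deriv (0, 1) h \<in> bumps c a b"
    using h by simp_all
qed

section \<open>Test functions on the unit square and uniqueness of weak derivatives\<close>

lemma unit_square_box: "unit_square = box (0, 0) (1, 1)"
  by (auto simp: unit_square_def mem_box Basis_prod_def)

lemma mem_box_prod_real: "p \<in> box a b \<longleftrightarrow> fst a < fst p \<and> fst p < fst b \<and> snd a < snd p \<and> snd p < snd b"
  for a b :: "real \<times> real"
  by (cases a, cases b, cases p) (auto simp: mem_box Basis_prod_def)

text \<open>Each product of flat functions lives on the box with corners moved inwards by
  \<open>1 / Suc n\<close>. Its closure stays in the open square even if the limiting box touches
  the sides.\<close>

lemma test_functions_tendsto_indicator:
  fixes a b :: "real \<times> real"
  assumes "0 \<le> fst a" "0 \<le> snd a" "fst b \<le> 1" "snd b \<le> 1"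
  obtains h :: "nat \<Rightarrow> real \<times> real \<Rightarrow> real"
  where "\<And>n. test_function unit_square (h n)" "\<And>n p. \<bar>h n p\<bar> \<le> 1"
    "\<And>p. (\<lambda>n. h n p) \<longlonglongrightarrow> indicator (box a b) p"
proof
  let ?c = "\<lambda>n. 1 / real (Suc n)"
  let ?a = "\<lambda>n. a + (?c n, ?c n)" and ?b = "\<lambda>n. b - (?c n, ?c n)"
  define h where "h n = (\<lambda>p. flat (?c n) 1 (fst p - fst (?a n)) * flat (?c n) 1 (fst (?b n) - fst p) *
      (flat (?c n) 1 (snd p - snd (?a n)) * flat (?c n) 1 (snd (?b n) - snd p)))" for n
  show "test_function unit_square (h n)" for n
  proof -
    have "h n \<in> bumps (?c n) (?a n) (?b n)"
      unfolding h_def by (rule bumps.prod)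
    then have "smooth (h n)"
      by (rule smooth_bumps[rotated]) simp
    moreover have "{p. h n p \<noteq> 0} \<subseteq> cbox (?a n) (?b n)"
    proof
      fix p assume "p \<in> {p. h n p \<noteq> 0}"
      then show "p \<in> cbox (?a n) (?b n)"
        by (cases p; cases a; cases b) (auto simp: h_def flat_def split: if_splits)
    qed
    then have supp: "closure {p. h n p \<noteq> 0} \<subseteq> cbox (?a n) (?b n)"
      by (rule closure_minimal) (rule closed_cbox)
    then have "compact (closure {p. h n p \<noteq> 0})"
      by (meson bounded_cbox bounded_subset compact_closure closure_subset order_trans)
    moreover have "cbox (a + (d, d)) (b - (d, d)) \<subseteq> unit_square" if "d > 0" for d
      using assms that by (cases a; cases b) (auto simp: unit_square_def)
    then have "cbox (?a n) (?b n) \<subseteq> unit_square"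
      by simp
    ultimately show ?thesis
      using supp by (auto simp: test_function_def)
  qed
  have bd: "0 \<le> flat (?c n) 1 x" "flat (?c n) 1 x \<le> 1" for n x
    using flat_one_bounds[of "?c n" x] by simp_all
  show "\<bar>h n p\<bar> \<le> 1" for n p
    unfolding h_def by (simp add: abs_mult bd mult_le_one del: of_nat_Suc)
  show "(\<lambda>n. h n p) \<longlonglongrightarrow> indicator (box a b) p" for p
  proof -
    have "(\<lambda>n. flat (?c n) 1 (fst p - fst a - ?c n) * flat (?c n) 1 (fst b - fst p - ?c n) *
      (flat (?c n) 1 (snd p - snd a - ?c n) * flat (?c n) 1 (snd b - snd p - ?c n))) \<longlonglongrightarrow>
      indicator {0<..} (fst p - fst a) * indicator {0<..} (fst b - fst p) *
        (indicator {0<..} (snd p - snd a) * indicator {0<..} (snd b - snd p))"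
      by (intro tendsto_mult flat_one_tendsto_indicator)
    moreover have "indicator {0<..} (fst p - fst a) * indicator {0<..} (fst b - fst p) *
        (indicator {0<..} (snd p - snd a) * indicator {0<..} (snd b - snd p)) = indicat_real (box a b) p"
      by (simp add: indicator_def mem_box_prod_real)
    moreover have "fst p - fst (?a n) = fst p - fst a - ?c n" "fst (?b n) - fst p = fst b - fst p - ?c n"
      "snd p - snd (?a n) = snd p - snd a - ?c n" "snd (?b n) - snd p = snd b - snd p - ?c n" for n
      by simp_all
    ultimately show ?thesis
      by (simp only: h_def)
  qed
qed

lemma lebesgue_sets_unit_square [simp]: "unit_square \<in> sets lebesgue"
  by (simp add: unit_square_box)

lemma L2_unit_square_integrable:
  assumes "f \<in> L2 unit_square"
  shows "integrable (lebesgue_on unit_square) f"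
proof -
  have "(\<lambda>_. 1) \<in> L2 unit_square"
    unfolding unit_square_box by (rule L2_continuous_box) simp
  from L2_mult_integrable[OF assms this] show ?thesis
    by simp
qed

text \<open>Indicators of boxes are bounded pointwise limits of test functions; dominated
  convergence with majorant \<open>\<bar>f\<bar>\<close> reduces the claim to boxes.\<close>

lemma AE_zero_if_orthogonal_test_functions:
  assumes f: "integrable (lebesgue_on unit_square) f"
    and zero: "\<And>h. test_function unit_square h \<Longrightarrow> (LINT p|lebesgue_on unit_square. f p * h p) = 0"
  shows "AE p in lebesgue_on unit_square. f p = 0"
proof (rule AE_zero_if_integral_box_zero[OF lebesgue_sets_unit_square f])
  fix a b :: "real \<times> real"
  \<comment> \<open>An arbitrary box is clipped to the closed square, which does not change its
    indicator on \<open>unit_square\<close>.\<close>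
  let ?a = "(max 0 (fst a), max 0 (snd a))" and ?b = "(min 1 (fst b), min 1 (snd b))"
  obtain h where h: "\<And>n. test_function unit_square (h n)" "\<And>n p. \<bar>h n p\<bar> \<le> 1"
    "\<And>p. (\<lambda>n. h n p) \<longlonglongrightarrow> indicator (box ?a ?b) p"
    by (rule test_functions_tendsto_indicator[of ?a ?b]) auto
  have "(\<lambda>n. LINT p|lebesgue_on unit_square. f p * h n p) \<longlonglongrightarrow>
    (LINT p|lebesgue_on unit_square. f p * indicator (box ?a ?b) p)"
  proof (rule integral_dominated_convergence[where w = "\<lambda>x. norm (f x)"])
    have fm: "f \<in> borel_measurable (lebesgue_on unit_square)"
      using f by simp
    have hm: "h n \<in> borel_measurable (lebesgue_on unit_square)" for n
    proof (rule continuous_imp_measurable_on_sets_lebesgue[OF _ lebesgue_sets_unit_square])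
      have "C_k 0 (h n)"
        using h(1) unfolding test_function_def smooth_def by blast
      then show "continuous_on unit_square (h n)"
        by (auto intro: continuous_on_subset)
    qed
    show "(\<lambda>p. f p * h n p) \<in> borel_measurable (lebesgue_on unit_square)" for n
      using fm hm by (rule borel_measurable_times)
    show "(\<lambda>p. f p * indicator (box ?a ?b) p) \<in> borel_measurable (lebesgue_on unit_square)"
      by (rule borel_measurable_LIMSEQ_real[OF _ borel_measurable_times[OF fm hm]]) (rule tendsto_mult[OF tendsto_const h(3)])
    show "AE p in lebesgue_on unit_square. (\<lambda>n. f p * h n p) \<longlonglongrightarrow> f p * indicator (box ?a ?b) p"
      by (intro AE_I2 tendsto_mult[OF tendsto_const h(3)])
    show "AE p in lebesgue_on unit_square. norm (f p * h n p) \<le> norm (f p)" for n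
      using h(2) by (intro AE_I2) (simp add: abs_mult mult_left_le)
  qed (use f in simp)
  then have "(LINT p|lebesgue_on unit_square. f p * indicator (box ?a ?b) p) = 0"
    unfolding zero[OF h(1)] by (rule LIMSEQ_unique[OF _ tendsto_const])
  moreover have "(LINT p|lebesgue_on unit_square. f p * indicator (box ?a ?b) p)
    = (LINT p|lebesgue_on unit_square. indicator (box a b) p * f p)"
    by (intro Bochner_Integration.integral_cong)
      (auto simp: indicator_def mem_box_prod_real unit_square_def)
  ultimately show "(LINT p|lebesgue_on unit_square. indicator (box a b) p * f p) = 0"
    by simp
qed

lemma test_function_continuous: "test_function S h \<Longrightarrow> continuous_on UNIV h"
  unfolding test_function_def smooth_def by (metis C_k.simps(1))

lemma smooth_continuous: "smooth h \<Longrightarrow> continuous_on A h"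
  unfolding smooth_def by (metis C_k.simps(1) continuous_on_subset subset_UNIV)

lemma continuous_L2_unit_square: "continuous_on UNIV h \<Longrightarrow> h \<in> L2 unit_square"
  unfolding unit_square_box by (rule L2_continuous_box) (auto intro: continuous_on_subset)

text \<open>This is how the representative chosen by \<open>weak_deriv\<close> is exchanged for an
  explicitly known weak derivative.\<close>

lemma has_weak_deriv_unique:
  assumes "has_weak_deriv unit_square \<alpha> v g1" "has_weak_deriv unit_square \<alpha> v g2"
  shows "AE p in lebesgue_on unit_square. g1 p = g2 p"
proof -
  have g: "g1 \<in> L2 unit_square" "g2 \<in> L2 unit_square"
    using assms by (auto simp: has_weak_deriv_def)
  have "AE p in lebesgue_on unit_square. g1 p - g2 p = 0"
  proof (rule AE_zero_if_orthogonal_test_functions)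
    show "integrable (lebesgue_on unit_square) (\<lambda>p. g1 p - g2 p)"
      using g by (intro L2_unit_square_integrable L2_diff)
    fix h assume h: "test_function unit_square h"
    have "(-1) ^ (fst \<alpha> + snd \<alpha>) * (LINT p|lebesgue_on unit_square. g1 p * h p)
      = (-1) ^ (fst \<alpha> + snd \<alpha>) * (LINT p|lebesgue_on unit_square. g2 p * h p)"
      using assms(1)[unfolded has_weak_deriv_def, THEN conjunct2, THEN conjunct2, rule_format, OF h]
        assms(2)[unfolded has_weak_deriv_def, THEN conjunct2, THEN conjunct2, rule_format, OF h]
      by simp
    then have "(LINT p|lebesgue_on unit_square. g1 p * h p) = (LINT p|lebesgue_on unit_square. g2 p * h p)"
      by simp
    then show "(LINT p|lebesgue_on unit_square. (g1 p - g2 p) * h p) = 0"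
      using g h by (simp add: left_diff_distrib L2_mult_integrable continuous_L2_unit_square test_function_continuous)
  qed
  then show ?thesis
    by simp
qed

lemma has_weak_deriv_weak_deriv:
  "has_weak_deriv S \<alpha> v g \<Longrightarrow> has_weak_deriv S \<alpha> v (weak_deriv S \<alpha> v)"
  unfolding weak_deriv_def by (rule someI[of "has_weak_deriv S \<alpha> v"])

subsection \<open>Integration by parts on the unit square\<close>

text \<open>\<open>d\<close> selects the coordinate direction: \<open>pt d r s\<close> has the coordinate \<open>r\<close> in direction \<open>d\<close>,
  so \<open>pt d 0\<close> and \<open>pt d 1\<close> parametrise the two sides orthogonal to this direction.\<close>

definition pt :: "bool \<Rightarrow> real \<Rightarrow> real \<Rightarrow> real \<times> real" where
  "pt d r s = (if d then (r, s) else (s, r))"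

definition idx :: "bool \<Rightarrow> nat \<times> nat" where
  "idx d = (if d then (1, 0) else (0, 1))"

lemma multi_deriv_idx: "multi_deriv (idx d) h = partial_deriv (pt d 1 0) h"
  by (simp add: idx_def pt_def)

lemma smooth_differentiable: "smooth h \<Longrightarrow> h differentiable (at p)"
  unfolding smooth_def by (metis C_k.simps(2))

lemma smooth_multi_deriv: "smooth h \<Longrightarrow> smooth (multi_deriv (idx d) h)"
  unfolding multi_deriv_idx smooth_def pt_def by (metis (full_types) C_k.simps(2))

lemma continuous_on_pt [continuous_intros]: "continuous_on A (pt d r)"
  by (cases d; auto simp: pt_def intro!: continuous_intros)

lemma smooth_has_real_derivative:
  assumes "smooth h"
  shows "((\<lambda>r. h (pt d r s)) has_real_derivative multi_deriv (idx d) h (pt d r s)) (at r)"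
proof -
  let ?D = "frechet_derivative h (at (pt d r s))"
  have h: "(h has_derivative ?D) (at (pt d r s))"
    using smooth_differentiable[OF assms] by (simp add: frechet_derivative_works)
  have "((\<lambda>r. pt d r s) has_derivative (\<lambda>x. pt d x 0)) (at r)"
    by (cases d) (auto simp: pt_def intro!: derivative_eq_intros)
  from has_derivative_compose[OF this h]
  have "((\<lambda>r. h (pt d r s)) has_derivative (\<lambda>x. ?D (pt d x 0))) (at r)" .
  moreover have "?D (pt d x 0) = multi_deriv (idx d) h (pt d r s) * x" for x
  proof -
    have "pt d x 0 = x *\<^sub>R pt d 1 0"
      by (simp add: pt_def)
    then show ?thesis
      using linear_cmul[OF has_derivative_linear[OF h], of x "pt d 1 0"]
      by (simp add: multi_deriv_idx partial_deriv_def)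
  qed
  ultimately show ?thesis
    by (simp add: has_field_derivative_def)
qed

text \<open>Off the closed support \<open>h\<close> vanishes on an open set, so its derivative
  vanishes there too and the support cannot grow.\<close>

lemma test_function_multi_deriv:
  assumes "test_function S h"
  shows "test_function S (multi_deriv (idx d) h)"
proof -
  let ?C = "closure {p. h p \<noteq> 0}"
  have "{p. multi_deriv (idx d) h p \<noteq> 0} \<subseteq> ?C"
  proof (rule ccontr)
    assume "\<not> ?thesis"
    then obtain p where p: "multi_deriv (idx d) h p \<noteq> 0" "p \<in> - ?C"
      by auto
    have "((\<lambda>_. 0) has_derivative (\<lambda>_. 0)) (at p)"
      by simp
    then have "(h has_derivative (\<lambda>_. 0)) (at p)"
    proof (rule has_derivative_transform_within_open[of _ _ _ _ "- ?C"])
      show "0 = h x" if "x \<in> - ?C" for x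
        using that closure_subset[of "{p. h p \<noteq> 0}"] by auto
    qed (use p in auto)
    from has_derivative_imp_partial_deriv[OF this] show False
      using p by (simp add: multi_deriv_idx)
  qed
  then have "closure {p. multi_deriv (idx d) h p \<noteq> 0} \<subseteq> ?C"
    by (rule closure_minimal) simp
  then show ?thesis
    using assms smooth_multi_deriv[of h d]
    unfolding test_function_def by (meson closed_closure closed_subset compact_closure bounded_subset compact_imp_bounded closure_subset order_trans)
qed

text \<open>A bridge from the Bochner integral over the open box, used in the definitions, to the
  gauge integral over the closed box, where Fubini and the fundamental theorem are applied.\<close>

lemma lebesgue_integral_box_eq:
  fixes f :: "'a::euclidean_space \<Rightarrow> real"
  assumes "continuous_on (cbox a b) f"
  shows "(LINT x|lebesgue_on (box a b). f x) = integral (cbox a b) f"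
proof -
  have "set_integrable lebesgue (box a b) f"
    using continuous_imp_integrable[OF assms] set_integrable_subset[of lebesgue "cbox a b" f "box a b"]
    by (simp add: integrable_restrict_space set_integrable_def box_subset_cbox)
  then have "integrable (lebesgue_on (box a b)) f"
    by (simp add: integrable_restrict_space set_integrable_def)
  then have "(LINT x|lebesgue_on (box a b). f x) = integral (box a b) f"
    by (simp add: lebesgue_integral_eq_integral)
  then show ?thesis
    by (simp add: integral_open_interval)
qed

lemma integral_derivative_unit_square:
  assumes F: "continuous_on UNIV F" and G: "continuous_on UNIV G"
    and deriv: "\<And>r s. ((\<lambda>r. F (pt d r s)) has_real_derivative G (pt d r s)) (at r)"
  shows "(LINT p|lebesgue_on unit_square. G p) =
    (LINT s|lebesgue_on {0<..<1}. F (pt d 1 s) - F (pt d 0 s))"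
proof -
  have cont: "continuous_on (cbox (0, 0) (1, 1)) G"
    using G by (rule continuous_on_subset) simp
  \<comment> \<open>Used for \<open>d = True\<close>, where the inner integration runs over the
    first coordinate.\<close>
  have swap: "integral (cbox 0 1) (\<lambda>x. integral (cbox 0 1) (\<lambda>y. G (x, y)))
    = integral (cbox 0 1) (\<lambda>y. integral (cbox 0 1) (\<lambda>x. G (x, y)))"
    using integral_swap_continuous[of 0 0 1 1 "\<lambda>x y. G (x, y)"] cont by simp
  have "(LINT p|lebesgue_on unit_square. G p) = integral (cbox (0, 0) (1, 1)) G"
    unfolding unit_square_box by (rule lebesgue_integral_box_eq[OF cont])
  also have "\<dots> = integral {0..1} (\<lambda>s. integral {0..1} (\<lambda>r. G (pt d r s)))"
    using integral_prod_continuous[OF cont] swap by (cases d) (simp_all add: pt_def)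
  also have "\<dots> = integral {0..1} (\<lambda>s. F (pt d 1 s) - F (pt d 0 s))"
  proof (rule Henstock_Kurzweil_Integration.integral_cong)
    fix s
    have "((\<lambda>r. G (pt d r s)) has_integral (F (pt d 1 s) - F (pt d 0 s))) {0..1}"
      using deriv by (intro fundamental_theorem_of_calculus)
        (auto simp flip: has_real_derivative_iff_has_vector_derivative intro: has_field_derivative_at_within)
    then show "integral {0..1} (\<lambda>r. G (pt d r s)) = F (pt d 1 s) - F (pt d 0 s)"
      by (rule integral_unique)
  qed
  also have "\<dots> = (LINT s|lebesgue_on (box 0 1). F (pt d 1 s) - F (pt d 0 s))"
  proof (rule lebesgue_integral_box_eq[symmetric, where a = "0::real" and b = 1, unfolded cbox_interval])
    show "continuous_on {0..1} (\<lambda>s. F (pt d 1 s) - F (pt d 0 s))"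
      by (intro continuous_intros continuous_on_compose2[OF F]) auto
  qed
  finally show ?thesis
    by (simp add: box_real)
qed

text \<open>The product rule, integrated. Only \<open>V\<close>, later an approximating function, is
  taken \<open>smooth\<close>; for \<psi> a continuous derivative in the direction \<open>d\<close>
  is asked, which is immediate for the modes and their first derivatives.\<close>

lemma integral_by_parts_unit_square:
  assumes V: "smooth V" and \<psi>: "continuous_on UNIV \<psi>" "continuous_on UNIV \<psi>'"
    and deriv: "\<And>r s. ((\<lambda>r. \<psi> (pt d r s)) has_real_derivative \<psi>' (pt d r s)) (at r)"
  shows "(LINT p|lebesgue_on unit_square. multi_deriv (idx d) V p * \<psi> p) =
    (LINT s|lebesgue_on {0<..<1}. V (pt d 1 s) * \<psi> (pt d 1 s) - V (pt d 0 s) * \<psi> (pt d 0 s))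
    - (LINT p|lebesgue_on unit_square. V p * \<psi>' p)"
proof -
  have c: "continuous_on UNIV V" "continuous_on UNIV (multi_deriv (idx d) V)"
    by (intro smooth_continuous smooth_multi_deriv V)+
  have "(LINT p|lebesgue_on unit_square. multi_deriv (idx d) V p * \<psi> p + V p * \<psi>' p)
     = (LINT s|lebesgue_on {0<..<1}. V (pt d 1 s) * \<psi> (pt d 1 s) - V (pt d 0 s) * \<psi> (pt d 0 s))"
    using DERIV_mult[OF smooth_has_real_derivative[OF V] deriv]
    by (intro integral_derivative_unit_square[of "\<lambda>p. V p * \<psi> p"] continuous_on_add continuous_on_mult c \<psi>)
      (simp add: algebra_simps)
  then show ?thesis
    using c \<psi> by (simp add: L2_mult_integrable continuous_L2_unit_square)
qed

text \<open>The points \<open>pt d 0 s\<close> and \<open>pt d 1 s\<close> lie outside the open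
  square, so a test function vanishes there and integration by parts has no boundary term.\<close>

lemma has_weak_deriv_smooth:
  assumes V: "smooth V"
  shows "has_weak_deriv unit_square (idx d) V (multi_deriv (idx d) V)"
proof -
  have "(LINT p|lebesgue_on unit_square. V p * multi_deriv (idx d) h p)
      = - (LINT p|lebesgue_on unit_square. multi_deriv (idx d) V p * h p)"
    if h: "test_function unit_square h" for h
  proof -
    have "smooth h"
      using h by (simp add: test_function_def)
    have "h p = 0" if "p \<notin> unit_square" for p
      using h that closure_subset[of "{p. h p \<noteq> 0}"] by (auto simp: test_function_def)
    then have "h (pt d 1 s) = 0" "h (pt d 0 s) = 0" for s
      by (auto simp: pt_def unit_square_def)
    then show ?thesis
      using integral_by_parts_unit_square[OF V, of h "multi_deriv (idx d) h" d]
        \<open>smooth h\<close> smooth_has_real_derivative[OF \<open>smooth h\<close>]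
      by (simp add: smooth_continuous smooth_multi_deriv)
  qed
  moreover have "fst (idx d) + snd (idx d) = 1"
    by (simp add: idx_def)
  ultimately show ?thesis
    using V unfolding has_weak_deriv_def
    by (simp add: continuous_L2_unit_square smooth_continuous smooth_multi_deriv)
qed

subsection \<open>Approximation by smooth functions and traces\<close>

lemma sobolev_L2: "v \<in> sobolev k S \<Longrightarrow> v \<in> L2 S"
  by (simp add: sobolev_def)

lemma sobolev_has_weak_deriv:
  "v \<in> sobolev k S \<Longrightarrow> fst \<alpha> + snd \<alpha> \<le> k \<Longrightarrow> has_weak_deriv S \<alpha> v (weak_deriv S \<alpha> v)"
  using has_weak_deriv_weak_deriv by (fastforce simp: sobolev_def)

lemma has_weak_deriv_L2: "has_weak_deriv S \<alpha> v g \<Longrightarrow> g \<in> L2 S"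
  by (simp add: has_weak_deriv_def)

lemma multi_index_le_1: "{\<alpha> :: nat \<times> nat. fst \<alpha> + snd \<alpha> \<le> 1} = {(0, 0), (1, 0), (0, 1)}"
  by (auto simp: le_Suc_eq)

lemma L2_norm_weak_deriv_le_sobolev_norm:
  assumes "fst \<alpha> + snd \<alpha> \<le> 1"
  shows "L2_norm S (weak_deriv S \<alpha> v) \<le> sobolev_norm 1 S v"
proof -
  have "finite {\<alpha> :: nat \<times> nat. fst \<alpha> + snd \<alpha> \<le> 1}"
    by (simp only: multi_index_le_1) simp
  then have "(L2_norm S (weak_deriv S \<alpha> v))\<^sup>2 \<le> (\<Sum>\<alpha> | fst \<alpha> + snd \<alpha> \<le> 1. (L2_norm S (weak_deriv S \<alpha> v))\<^sup>2)"
    using assms by (intro member_le_sum) auto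
  then show ?thesis
    unfolding sobolev_norm_def by (rule real_le_rsqrt)
qed

lemma has_weak_deriv_diff:
  assumes "has_weak_deriv unit_square \<alpha> v g" "has_weak_deriv unit_square \<alpha> v' g'"
    and int: "\<And>h. test_function unit_square h \<Longrightarrow> multi_deriv \<alpha> h \<in> L2 unit_square"
  shows "has_weak_deriv unit_square \<alpha> (\<lambda>p. v p - v' p) (\<lambda>p. g p - g' p)"
  unfolding has_weak_deriv_def
proof (intro conjI allI impI)
  note * = assms(1,2)[unfolded has_weak_deriv_def]
  show "(\<lambda>p. v p - v' p) \<in> L2 unit_square" "(\<lambda>p. g p - g' p) \<in> L2 unit_square"
    using * by (auto intro: L2_diff)
  fix h assume h: "test_function unit_square h"
  have "h \<in> L2 unit_square"
    using h by (intro continuous_L2_unit_square test_function_continuous)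
  then show "(LINT p|lebesgue_on unit_square. (v p - v' p) * multi_deriv \<alpha> h p) =
      (-1) ^ (fst \<alpha> + snd \<alpha>) * (LINT p|lebesgue_on unit_square. (g p - g' p) * h p)"
    using * h int[OF h] by (simp add: left_diff_distrib L2_mult_integrable right_diff_distrib)
qed

text \<open>\<open>sobolev_norm\<close> speaks of the chosen derivative of the difference
  \<open>V n - v\<close>. By uniqueness it agrees almost everywhere with the difference
  \<open>G n - g\<close> of known derivatives.\<close>

lemma L2_norm_smooth_diff_tendsto_0:
  assumes v: "v \<in> sobolev 1 unit_square" and V: "\<And>n. smooth (V n)"
    and lim: "(\<lambda>n::nat. sobolev_norm 1 unit_square (\<lambda>p. V n p - v p)) \<longlonglongrightarrow> 0"
    and \<alpha>: "fst \<alpha> + snd \<alpha> \<le> 1"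
    and G: "\<And>n. has_weak_deriv unit_square \<alpha> (V n) (G n)"
    and g: "has_weak_deriv unit_square \<alpha> v g"
    and int: "\<And>h. test_function unit_square h \<Longrightarrow> multi_deriv \<alpha> h \<in> L2 unit_square"
  shows "(\<lambda>n. L2_norm unit_square (\<lambda>p. G n p - g p)) \<longlonglongrightarrow> 0"
proof (rule tendsto_sandwich[OF _ _ tendsto_const lim])
  have "L2_norm unit_square (\<lambda>p. G n p - g p) \<le> sobolev_norm 1 unit_square (\<lambda>p. V n p - v p)" for n
  proof -
    have d: "has_weak_deriv unit_square \<alpha> (\<lambda>p. V n p - v p) (\<lambda>p. G n p - g p)"
      by (rule has_weak_deriv_diff[OF G g int])
    note d' = has_weak_deriv_weak_deriv[OF d]
    have "L2_norm unit_square (\<lambda>p. G n p - g p)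
        = L2_norm unit_square (weak_deriv unit_square \<alpha> (\<lambda>p. V n p - v p))"
      by (intro L2_norm_cong_AE has_weak_deriv_unique[OF d d'] L2_measurable
          has_weak_deriv_L2[OF d] has_weak_deriv_L2[OF d'])
    then show ?thesis
      using L2_norm_weak_deriv_le_sobolev_norm[OF \<alpha>, of unit_square "\<lambda>p. V n p - v p"] by simp
  qed
  then show "\<forall>\<^sub>F n in sequentially. L2_norm unit_square (\<lambda>p. G n p - g p) \<le> sobolev_norm 1 unit_square (\<lambda>p. V n p - v p)"
    by simp
  show "\<forall>\<^sub>F n in sequentially. 0 \<le> L2_norm unit_square (\<lambda>p. G n p - g p)"
    by (simp add: L2_norm_nonneg)
qed

text \<open>The form of integration by parts that survives the passage to the limit: the boundary term
  only has to vanish asymptotically.\<close>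

lemma weak_integral_by_parts:
  assumes v: "v \<in> sobolev 1 unit_square" and V: "\<And>n. smooth (V n)"
    and lim: "(\<lambda>n::nat. sobolev_norm 1 unit_square (\<lambda>p. V n p - v p)) \<longlonglongrightarrow> 0"
    and \<psi>: "continuous_on UNIV \<psi>" "continuous_on UNIV \<psi>'"
    and deriv: "\<And>r s. ((\<lambda>r. \<psi> (pt d r s)) has_real_derivative \<psi>' (pt d r s)) (at r)"
    and boundary: "(\<lambda>n. LINT s|lebesgue_on {0<..<1}.
        V n (pt d 1 s) * \<psi> (pt d 1 s) - V n (pt d 0 s) * \<psi> (pt d 0 s)) \<longlonglongrightarrow> 0"
  shows "(LINT p|lebesgue_on unit_square. weak_deriv unit_square (idx d) v p * \<psi> p) =
    - (LINT p|lebesgue_on unit_square. v p * \<psi>' p)"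
proof (rule LIMSEQ_unique)
  have idx: "fst (idx d) + snd (idx d) \<le> 1"
    by (simp add: idx_def)
  note vL2 = sobolev_L2[OF v] and vd = sobolev_has_weak_deriv[OF v idx]
  have VL2: "V n \<in> L2 unit_square" "multi_deriv (idx d) (V n) \<in> L2 unit_square" for n
    by (intro continuous_L2_unit_square smooth_continuous smooth_multi_deriv V)+
  have tL2: "multi_deriv (idx d) h \<in> L2 unit_square" "h \<in> L2 unit_square" if "test_function unit_square h" for h
    using that test_function_multi_deriv[OF that]
    by (auto intro: continuous_L2_unit_square test_function_continuous)
  \<comment> \<open>The index \<open>(0, 0)\<close> of the Sobolev norm yields convergence of the
    functions themselves.\<close>
  have zero: "has_weak_deriv unit_square (0, 0) w w" if "w \<in> L2 unit_square" for w
    using that by (simp add: has_weak_deriv_def)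
  have "(\<lambda>n. L2_norm unit_square (\<lambda>p. V n p - v p)) \<longlonglongrightarrow> 0"
    by (rule L2_norm_smooth_diff_tendsto_0[OF v V lim _ zero[OF VL2(1)] zero[OF vL2]]) (use tL2 in simp_all)
  then have "(\<lambda>n. LINT p|lebesgue_on unit_square. V n p * \<psi>' p) \<longlonglongrightarrow> (LINT p|lebesgue_on unit_square. v p * \<psi>' p)"
    by (intro L2_inner_tendsto always_eventually allI VL2 vL2 continuous_L2_unit_square \<psi>)
  then have "(\<lambda>n. (LINT s|lebesgue_on {0<..<1}. V n (pt d 1 s) * \<psi> (pt d 1 s) - V n (pt d 0 s) * \<psi> (pt d 0 s))
      - (LINT p|lebesgue_on unit_square. V n p * \<psi>' p)) \<longlonglongrightarrow> 0 - (LINT p|lebesgue_on unit_square. v p * \<psi>' p)"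
    by (intro tendsto_diff boundary)
  then show "(\<lambda>n. LINT p|lebesgue_on unit_square. multi_deriv (idx d) (V n) p * \<psi> p)
      \<longlonglongrightarrow> - (LINT p|lebesgue_on unit_square. v p * \<psi>' p)"
    by (simp add: integral_by_parts_unit_square[OF V \<psi> deriv])
  have "(\<lambda>n. L2_norm unit_square (\<lambda>p. multi_deriv (idx d) (V n) p - weak_deriv unit_square (idx d) v p)) \<longlonglongrightarrow> 0"
    by (rule L2_norm_smooth_diff_tendsto_0[OF v V lim idx has_weak_deriv_smooth[OF V] vd tL2(1)])
  then show "(\<lambda>n. LINT p|lebesgue_on unit_square. multi_deriv (idx d) (V n) p * \<psi> p)
      \<longlonglongrightarrow> (LINT p|lebesgue_on unit_square. weak_deriv unit_square (idx d) v p * \<psi> p)"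
    by (intro L2_inner_tendsto always_eventually allI VL2 has_weak_deriv_L2[OF vd] continuous_L2_unit_square \<psi>)
qed

text \<open>The trace hypothesis only supplies smooth functions converging to \<open>v\<close> in
  the Sobolev norm; hence \<gamma> may parametrise a side unrelated to the direction
  \<open>d\<close>.\<close>

lemma weak_integral_by_parts_vanishing:
  assumes tr: "has_trace \<gamma> v w"
    and \<psi>: "continuous_on UNIV \<psi>" "continuous_on UNIV \<psi>'"
    and deriv: "\<And>r s. ((\<lambda>r. \<psi> (pt d r s)) has_real_derivative \<psi>' (pt d r s)) (at r)"
    and zero: "\<And>s. \<psi> (pt d 0 s) = 0" "\<And>s. \<psi> (pt d 1 s) = 0"
  shows "(LINT p|lebesgue_on unit_square. weak_deriv unit_square (idx d) v p * \<psi> p) =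
    - (LINT p|lebesgue_on unit_square. v p * \<psi>' p)"
proof -
  from tr obtain V where v: "v \<in> sobolev 1 unit_square" and V: "\<And>n. smooth (V n)"
    and lim: "(\<lambda>n::nat. sobolev_norm 1 unit_square (\<lambda>p. V n p - v p)) \<longlonglongrightarrow> 0"
    unfolding has_trace_def by blast
  show ?thesis
    by (rule weak_integral_by_parts[OF v V lim \<psi> deriv]) (simp add: zero)
qed

text \<open>On the side \<open>j\<close> the approximations tend to 0 in \<open>L2\<close>, on the
  opposite side \<psi> itself is 0; so the boundary term vanishes in the limit.\<close>

lemma weak_integral_by_parts_trace_0:
  assumes tr: "has_trace (pt d j) v (\<lambda>_. 0)" and j: "j = 0 \<or> j = 1"
    and \<psi>: "continuous_on UNIV \<psi>" "continuous_on UNIV \<psi>'"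
    and deriv: "\<And>r s. ((\<lambda>r. \<psi> (pt d r s)) has_real_derivative \<psi>' (pt d r s)) (at r)"
    and zero: "\<And>s. \<psi> (pt d (1 - j) s) = 0"
  shows "(LINT p|lebesgue_on unit_square. weak_deriv unit_square (idx d) v p * \<psi> p) =
    - (LINT p|lebesgue_on unit_square. v p * \<psi>' p)"
proof -
  from tr obtain V where v: "v \<in> sobolev 1 unit_square" and V: "\<And>n. smooth (V n)"
    and lim: "(\<lambda>n::nat. sobolev_norm 1 unit_square (\<lambda>p. V n p - v p)) \<longlonglongrightarrow> 0"
    and lim': "(\<lambda>n. L2_norm {0<..<1} (\<lambda>s. V n (pt d j s) - 0)) \<longlonglongrightarrow> 0"
    unfolding has_trace_def by blast
  show ?thesis
  proof (rule weak_integral_by_parts[OF v V lim \<psi> deriv])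
    have L2: "(\<lambda>s. f (pt d j s)) \<in> L2 {0<..<1}" if "continuous_on UNIV f" for f :: "real \<times> real \<Rightarrow> real"
      unfolding box_real(1)[symmetric]
      by (intro L2_continuous_box continuous_on_compose2[OF that] continuous_intros) auto
    have "(\<lambda>n. LINT s|lebesgue_on {0<..<1}. V n (pt d j s) * \<psi> (pt d j s))
        \<longlonglongrightarrow> (LINT s|lebesgue_on {0<..<1}. 0 * \<psi> (pt d j s))"
      using tr lim' by (intro L2_inner_tendsto always_eventually allI L2[OF smooth_continuous[OF V]] L2[OF \<psi>(1)]) (auto simp: has_trace_def)
    then have *: "(\<lambda>n. LINT s|lebesgue_on {0<..<1}. V n (pt d j s) * \<psi> (pt d j s)) \<longlonglongrightarrow> 0"
      by simp
    show "(\<lambda>n. LINT s|lebesgue_on {0<..<1}.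
        V n (pt d 1 s) * \<psi> (pt d 1 s) - V n (pt d 0 s) * \<psi> (pt d 0 s)) \<longlonglongrightarrow> 0"
      using j
    proof
      assume "j = 0"
      then show ?thesis
        using tendsto_minus[OF *] zero by simp
    next
      assume "j = 1"
      then show ?thesis
        using * zero by simp
    qed
  qed
qed

text \<open>A partition of unity separates the two sides, whose traces are given by different
  approximating sequences.\<close>

lemma weak_integral_by_parts_traces_0:
  assumes tr: "has_trace (pt d 0) v (\<lambda>_. 0)" "has_trace (pt d 1) v (\<lambda>_. 0)"
    and \<psi>: "continuous_on UNIV \<psi>" "continuous_on UNIV \<psi>'"
    and deriv: "\<And>r s. ((\<lambda>r. \<psi> (pt d r s)) has_real_derivative \<psi>' (pt d r s)) (at r)"
  shows "(LINT p|lebesgue_on unit_square. weak_deriv unit_square (idx d) v p * \<psi> p) =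
    - (LINT p|lebesgue_on unit_square. v p * \<psi>' p)"
proof -
  define co where "co p = (if d then fst p else snd p)" for p :: "real \<times> real"
  have co: "co (pt d r s) = r" for r s
    by (simp add: co_def pt_def)
  have c: "continuous_on UNIV co"
    by (cases d) (auto simp: co_def intro!: continuous_intros)
  \<comment> \<open>\<open>?a\<close> vanishes on the side \<open>co = 1\<close> and
    \<open>?b\<close> on \<open>co = 0\<close>. The terms \<open>- \<psi>\<close> and
    \<open>+ \<psi>\<close> from differentiating the cutoffs cancel in the sum.\<close>
  let ?a = "\<lambda>p. (1 - co p) * \<psi> p" and ?a' = "\<lambda>p. (1 - co p) * \<psi>' p - \<psi> p"
  let ?b = "\<lambda>p. co p * \<psi> p" and ?b' = "\<lambda>p. co p * \<psi>' p + \<psi> p"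
  let ?g = "weak_deriv unit_square (idx d) v"
  have v: "v \<in> sobolev 1 unit_square"
    using tr by (simp add: has_trace_def)
  have vL2: "v \<in> L2 unit_square" "?g \<in> L2 unit_square"
    using sobolev_L2[OF v] has_weak_deriv_L2[OF sobolev_has_weak_deriv[OF v]] by (auto simp: idx_def)
  have cL2: "?a \<in> L2 unit_square" "?a' \<in> L2 unit_square" "?b \<in> L2 unit_square" "?b' \<in> L2 unit_square"
    by (intro continuous_L2_unit_square continuous_intros c \<psi>)+
  have a: "(LINT p|lebesgue_on unit_square. ?g p * ?a p) = - (LINT p|lebesgue_on unit_square. v p * ?a' p)"
  proof (rule weak_integral_by_parts_trace_0[OF tr(1)])
    show "((\<lambda>r. ?a (pt d r s)) has_real_derivative ?a' (pt d r s)) (at r)" for r s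
      unfolding co using deriv[of s r] by (auto intro!: derivative_eq_intros)
  qed (auto simp: co intro!: continuous_intros c \<psi>)
  have b: "(LINT p|lebesgue_on unit_square. ?g p * ?b p) = - (LINT p|lebesgue_on unit_square. v p * ?b' p)"
  proof (rule weak_integral_by_parts_trace_0[OF tr(2)])
    show "((\<lambda>r. ?b (pt d r s)) has_real_derivative ?b' (pt d r s)) (at r)" for r s
      unfolding co using deriv[of s r] by (auto intro!: derivative_eq_intros)
  qed (auto simp: co intro!: continuous_intros c \<psi>)
  have "(LINT p|lebesgue_on unit_square. ?g p * \<psi> p)
    = (LINT p|lebesgue_on unit_square. ?g p * ?a p + ?g p * ?b p)"
    by (intro Bochner_Integration.integral_cong) (auto simp: algebra_simps)
  also have "\<dots> = - ((LINT p|lebesgue_on unit_square. v p * ?a' p) + (LINT p|lebesgue_on unit_square. v p * ?b' p))"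
    using vL2 cL2 a b by (simp only: Bochner_Integration.integral_add L2_mult_integrable)
  also have "\<dots> = - (LINT p|lebesgue_on unit_square. v p * ?a' p + v p * ?b' p)"
    using vL2 cL2 by (simp only: Bochner_Integration.integral_add L2_mult_integrable)
  also have "\<dots> = - (LINT p|lebesgue_on unit_square. v p * \<psi>' p)"
    by (intro arg_cong[where f = uminus] Bochner_Integration.integral_cong) (auto simp: algebra_simps)
  finally show ?thesis .
qed

subsection \<open>Green's formula for the separated solutions\<close>

definition idx2 :: "bool \<Rightarrow> nat \<times> nat" where
  "idx2 d = (if d then (2, 0) else (0, 2))"

lemma multi_deriv_idx2: "multi_deriv (idx2 d) h = multi_deriv (idx d) (multi_deriv (idx d) h)"
  by (simp add: idx2_def idx_def numeral_2_eq_2)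

text \<open>The first derivative of a test function is again a test function, and the two signs
  cancel. This links the second derivatives in \<open>laplacian\<close> to the first derivatives
  whose traces are prescribed.\<close>

lemma has_weak_deriv_idx2:
  assumes u: "has_weak_deriv S (idx d) u q" and q: "has_weak_deriv S (idx d) q g"
  shows "has_weak_deriv S (idx2 d) u g"
proof -
  have "(LINT p|lebesgue_on S. u p * multi_deriv (idx2 d) h p) = (LINT p|lebesgue_on S. g p * h p)"
    if h: "test_function S h" for h
  proof -
    have "(LINT p|lebesgue_on S. u p * multi_deriv (idx2 d) h p)
        = - (LINT p|lebesgue_on S. q p * multi_deriv (idx d) h p)"
      unfolding multi_deriv_idx2
      using u[unfolded has_weak_deriv_def, THEN conjunct2, THEN conjunct2, rule_format, OF test_function_multi_deriv[OF h]]
      by (simp add: idx_def split: if_splits)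
    also have "\<dots> = (LINT p|lebesgue_on S. g p * h p)"
      using q[unfolded has_weak_deriv_def, THEN conjunct2, THEN conjunct2, rule_format, OF h]
      by (simp add: idx_def split: if_splits)
    finally show ?thesis .
  qed
  moreover have "(-1) ^ (fst (idx2 d) + snd (idx2 d)) = (1::real)"
    by (simp add: idx2_def)
  ultimately show ?thesis
    using u q by (simp add: has_weak_deriv_def)
qed

definition mode :: "real \<Rightarrow> nat \<Rightarrow> real \<times> real \<Rightarrow> real" where
  "mode l n p = cosh (l * fst p) * cos (real n * pi * snd p)"

lemma continuous_mode: "continuous_on A (mode l n)"
  unfolding mode_def cosh_field_def by (auto intro!: continuous_intros)

lemma mode_L2: "mode l n \<in> L2 unit_square"
  by (intro continuous_L2_unit_square continuous_mode)

text \<open>One half of Green's formula: the Neumann traces remove the boundary term whatever \<psi>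
  does on the sides. The second integration by parts is left as the hypothesis \<open>u\<close>,
  since it is justified differently in the two directions.\<close>

lemma weak_second_deriv_by_parts:
  assumes q: "has_weak_deriv unit_square (idx d) u (weak_deriv unit_square (idx d) u)"
    and tr: "has_trace (pt d 0) (weak_deriv unit_square (idx d) u) (\<lambda>_. 0)"
      "has_trace (pt d 1) (weak_deriv unit_square (idx d) u) (\<lambda>_. 0)"
    and c: "continuous_on UNIV \<psi>" "continuous_on UNIV \<psi>'"
    and deriv: "\<And>r s. ((\<lambda>r. \<psi> (pt d r s)) has_real_derivative \<psi>' (pt d r s)) (at r)"
    and u: "(LINT p|lebesgue_on unit_square. weak_deriv unit_square (idx d) u p * \<psi>' p) =
      - (LINT p|lebesgue_on unit_square. u p * \<psi>'' p)"
  shows "(LINT p|lebesgue_on unit_square. weak_deriv unit_square (idx2 d) u p * \<psi> p)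
      = (LINT p|lebesgue_on unit_square. u p * \<psi>'' p)"
proof -
  let ?q = "weak_deriv unit_square (idx d) u" and ?g = "weak_deriv unit_square (idx2 d) u"
  let ?g' = "weak_deriv unit_square (idx d) ?q"
  have "?q \<in> sobolev 1 unit_square"
    using tr by (simp add: has_trace_def)
  then have "has_weak_deriv unit_square (idx d) ?q ?g'"
    by (rule sobolev_has_weak_deriv) (simp add: idx_def)
  then have g': "has_weak_deriv unit_square (idx2 d) u ?g'"
    by (rule has_weak_deriv_idx2[OF q])
  then have g: "has_weak_deriv unit_square (idx2 d) u ?g"
    by (rule has_weak_deriv_weak_deriv)
  have "\<psi> \<in> L2 unit_square"
    by (intro continuous_L2_unit_square c)
  have "(LINT p|lebesgue_on unit_square. ?g p * \<psi> p) = (LINT p|lebesgue_on unit_square. ?g' p * \<psi> p)"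
  proof (rule integral_cong_AE)
    show "AE p in lebesgue_on unit_square. ?g p * \<psi> p = ?g' p * \<psi> p"
      using has_weak_deriv_unique[OF g g'] by eventually_elim simp
  qed (intro borel_measurable_times L2_measurable has_weak_deriv_L2[OF g] has_weak_deriv_L2[OF g'] \<open>\<psi> \<in> _\<close>)+
  also have "\<dots> = - (LINT p|lebesgue_on unit_square. ?q p * \<psi>' p)"
    by (rule weak_integral_by_parts_traces_0[OF tr c deriv])
  finally show ?thesis
    by (simp add: u)
qed

lemma idx_simps: "idx True = (1, 0)" "idx False = (0, 1)" "idx2 True = (2, 0)" "idx2 False = (0, 2)"
  and pt_simps: "pt True r = (\<lambda>s. (r, s))" "pt False r = (\<lambda>s. (s, r))"
  by (simp_all add: idx_def idx2_def pt_def fun_eq_iff)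

lemma integral_laplacian_mode:
  assumes u: "u \<in> sobolev 2 unit_square"
    and tr: "has_trace (\<lambda>y. (0, y)) (weak_deriv unit_square (1, 0) u) (\<lambda>_. 0)"
      "has_trace (\<lambda>y. (1, y)) (weak_deriv unit_square (1, 0) u) (\<lambda>_. 0)"
      "has_trace (\<lambda>x. (x, 0)) (weak_deriv unit_square (0, 1) u) (\<lambda>_. 0)"
      "has_trace (\<lambda>x. (x, 1)) (weak_deriv unit_square (0, 1) u) (\<lambda>_. 0)"
      "has_trace (\<lambda>y. (1, y)) u (\<lambda>_. 0)"
  shows "laplacian unit_square u \<in> L2 unit_square"
    and "(LINT p|lebesgue_on unit_square. laplacian unit_square u p * mode l n p)
      = (l\<^sup>2 - (real n * pi)\<^sup>2) * (LINT p|lebesgue_on unit_square. u p * mode l n p)"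
proof -
  have d: "has_weak_deriv unit_square \<alpha> u (weak_deriv unit_square \<alpha> u)" if "fst \<alpha> + snd \<alpha> \<le> 2" for \<alpha>
    by (rule sobolev_has_weak_deriv[OF u that])
  have L2: "weak_deriv unit_square (2, 0) u \<in> L2 unit_square" "weak_deriv unit_square (0, 2) u \<in> L2 unit_square"
    by (rule has_weak_deriv_L2[OF d], simp)+
  then show "laplacian unit_square u \<in> L2 unit_square"
    unfolding laplacian_def by (rule L2_add)
  let ?wx = "\<lambda>p. l * sinh (l * fst p) * cos (real n * pi * snd p)"
  let ?wy = "\<lambda>p. - (real n * pi) * (cosh (l * fst p) * sin (real n * pi * snd p))"
  have c: "continuous_on UNIV ?wx" "continuous_on UNIV ?wy"
    unfolding cosh_field_def sinh_field_def by (auto intro!: continuous_intros)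
  have cc: "continuous_on UNIV (\<lambda>p. k * mode l n p)" for k
    by (intro continuous_intros continuous_mode)
  have x: "(LINT p|lebesgue_on unit_square. weak_deriv unit_square (2, 0) u p * mode l n p)
      = (LINT p|lebesgue_on unit_square. u p * (l\<^sup>2 * mode l n p))"
  proof (rule weak_second_deriv_by_parts[of True, unfolded idx_simps pt_simps])
    show "((\<lambda>r. mode l n (r, s)) has_real_derivative ?wx (r, s)) (at r)" for r s
      unfolding mode_def by (auto intro!: derivative_eq_intros)
    show "(LINT p|lebesgue_on unit_square. weak_deriv unit_square (1, 0) u p * ?wx p) =
        - (LINT p|lebesgue_on unit_square. u p * (l\<^sup>2 * mode l n p))"
    \<comment> \<open>At \<open>x = 1\<close> the trace of \<open>u\<close> is zero; at
      \<open>x = 0\<close> the factor \<open>sinh (l * x)\<close> is zero.\<close>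
    proof (rule weak_integral_by_parts_trace_0[of True 1, unfolded idx_simps pt_simps])
      show "((\<lambda>r. ?wx (r, s)) has_real_derivative l\<^sup>2 * mode l n (r, s)) (at r)" for r s
        unfolding mode_def by (auto intro!: derivative_eq_intros simp: power2_eq_square)
    qed (use tr c cc in auto)
  qed (use tr c d continuous_mode in auto)
  have y: "(LINT p|lebesgue_on unit_square. weak_deriv unit_square (0, 2) u p * mode l n p)
      = (LINT p|lebesgue_on unit_square. u p * (- ((real n * pi)\<^sup>2) * mode l n p))"
  proof (rule weak_second_deriv_by_parts[of False, unfolded idx_simps pt_simps])
    show "((\<lambda>r. mode l n (s, r)) has_real_derivative ?wy (s, r)) (at r)" for r s
      unfolding mode_def by (auto intro!: derivative_eq_intros)
    show "(LINT p|lebesgue_on unit_square. weak_deriv unit_square (0, 1) u p * ?wy p) =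
        - (LINT p|lebesgue_on unit_square. u p * (- ((real n * pi)\<^sup>2) * mode l n p))"
    \<comment> \<open>The sine vanishes at \<open>y = 0\<close> and \<open>y = 1\<close>, so no
      values of \<open>u\<close> on these sides are needed; the trace on \<open>x = 1\<close> only
      provides the approximating sequence.\<close>
    proof (rule weak_integral_by_parts_vanishing[of _ _ _ _ _ False, unfolded idx_simps pt_simps])
      show "((\<lambda>r. ?wy (s, r)) has_real_derivative - ((real n * pi)\<^sup>2) * mode l n (s, r)) (at r)" for r s
        unfolding mode_def by (auto intro!: derivative_eq_intros simp: power2_eq_square)
      show "has_trace (\<lambda>y. (1, y)) u (\<lambda>_. 0)"
        by (rule tr)
    qed (use c cc[of "- ((real n * pi)\<^sup>2)"] in auto)
  qed (use tr c d continuous_mode in auto)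
  have "(LINT p|lebesgue_on unit_square. laplacian unit_square u p * mode l n p)
      = (LINT p|lebesgue_on unit_square. weak_deriv unit_square (2, 0) u p * mode l n p)
        + (LINT p|lebesgue_on unit_square. weak_deriv unit_square (0, 2) u p * mode l n p)"
    using L2 by (simp add: laplacian_def distrib_right L2_mult_integrable mode_L2)
  also have "\<dots> = l\<^sup>2 * (LINT p|lebesgue_on unit_square. u p * mode l n p)
      + (- ((real n * pi)\<^sup>2)) * (LINT p|lebesgue_on unit_square. u p * mode l n p)"
    unfolding x y by (simp only: mult.left_commute[of "u _"] integral_mult_right_zero)
  finally show "(LINT p|lebesgue_on unit_square. laplacian unit_square u p * mode l n p)
      = (l\<^sup>2 - (real n * pi)\<^sup>2) * (LINT p|lebesgue_on unit_square. u p * mode l n p)"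
    by (simp add: left_diff_distrib)
qed

subsection \<open>Evolution of the modes\<close>

text \<open>Pairing with a fixed \<open>w\<close> is linear and continuous in the \<open>L2\<close>
  norm, so it commutes with the limit of difference quotients.\<close>

lemma has_L2_time_deriv_inner:
  assumes u: "\<And>t. t \<in> {0..1} \<Longrightarrow> u t \<in> L2 S" and d: "has_L2_time_deriv S u d t"
    and t: "t \<in> {0..1}" and w: "w \<in> L2 S"
  shows "((\<lambda>t. LINT p|lebesgue_on S. u t p * w p) has_real_derivative (LINT p|lebesgue_on S. d p * w p))
    (at t within {0..1})"
proof -
  let ?I = "\<lambda>t. LINT p|lebesgue_on S. u t p * w p"
  have q: "(\<lambda>p. (u s p - u t p) / (s - t)) \<in> L2 S" if "s \<in> {0..1}" for s
    using L2_cmult[OF L2_diff[OF u[OF that] u[OF t]], of "1 / (s - t)"] by simp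
  have "((\<lambda>s. LINT p|lebesgue_on S. (u s p - u t p) / (s - t) * w p) \<longlongrightarrow> (LINT p|lebesgue_on S. d p * w p))
      (at t within {0..1})"
    using d w q by (intro L2_inner_tendsto) (auto simp: has_L2_time_deriv_def eventually_at_filter)
  moreover have "\<forall>\<^sub>F s in at t within {0..1}.
      (LINT p|lebesgue_on S. (u s p - u t p) / (s - t) * w p) = (?I s - ?I t) / (s - t)"
  proof -
    have "(LINT p|lebesgue_on S. (u s p - u t p) / (s - t) * w p) = (?I s - ?I t) / (s - t)"
      if s: "s \<in> {0..1}" for s
    proof -
      have "(LINT p|lebesgue_on S. (u s p - u t p) / (s - t) * w p)
        = (LINT p|lebesgue_on S. (u s p * w p - u t p * w p) / (s - t))"
        by (intro Bochner_Integration.integral_cong) (auto simp: left_diff_distrib)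
      also have "\<dots> = (?I s - ?I t) / (s - t)"
        using Bochner_Integration.integral_diff[OF L2_mult_integrable[OF u[OF s] w] L2_mult_integrable[OF u[OF t] w]]
        by simp
      finally show ?thesis .
    qed
    then show ?thesis
      unfolding eventually_at_filter by (intro always_eventually allI impI)
  qed
  ultimately have "((\<lambda>s. (?I s - ?I t) / (s - t)) \<longlongrightarrow> (LINT p|lebesgue_on S. d p * w p)) (at t within {0..1})"
    by (rule Lim_transform_eventually)
  then show ?thesis
    by (simp add: has_field_derivative_iff)
qed

lemma AE_lebesgue_on_negligible:
  assumes "AE t in lebesgue_on S. P t" "S \<in> sets lebesgue"
  obtains N where "negligible N" "\<And>t. t \<in> S - N \<Longrightarrow> P t"
proof -
  have "AE t in lebesgue. t \<in> S \<longrightarrow> P t"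
    using assms by (simp add: AE_restrict_space_iff)
  then obtain N where "N \<in> null_sets lebesgue" "{t \<in> space lebesgue. \<not> (t \<in> S \<longrightarrow> P t)} \<subseteq> N"
    unfolding eventually_ae_filter by blast
  then show thesis
    by (intro that[of N]) (auto simp: negligible_iff_null_sets)
qed

text \<open>The mode is an eigenfunction of the Laplacian for the eigenvalue \<open>- m l n\<close>.
  The factor \<open>exp (m l n * t)\<close> therefore cancels the diffusion term in the derivative
  of the pairing and leaves only the source.\<close>

lemma mode_evolution:
  assumes sol: "solves_source_problem \<phi> g0 g1 u f" and s: "s \<in> {0..1}"
  defines "m \<equiv> \<lambda>l n. (real n * pi)\<^sup>2 - l\<^sup>2"
  shows "exp (m l n * s) * (LINT p|lebesgue_on unit_square. u s p * mode l n p)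
      - (LINT p|lebesgue_on unit_square. u 0 p * mode l n p)
    = integral {0..s} (\<lambda>t. exp (m l n * t) * \<phi> t) * (LINT p|lebesgue_on unit_square. f p * mode l n p)"
proof -
  let ?S = "unit_square" and ?w = "mode l n"
  let ?I = "\<lambda>v. LINT p|lebesgue_on ?S. v p * ?w p" and ?m = "m l n"
  have C1: "u \<in> C1_L2 ?S" and H2: "u \<in> L2_H2 ?S" and f: "f \<in> L2 ?S"
    using sol by (auto simp: solves_source_problem_def)
  have uL2: "u t \<in> L2 ?S" if "t \<in> {0..1}" for t
    using C1 that by (auto simp: C1_L2_def)
  have td: "has_L2_time_deriv ?S u (time_deriv ?S u t) t" if "t \<in> {0..1}" for t
  proof -
    obtain d where "has_L2_time_deriv ?S u d t"
      using C1 \<open>t \<in> {0..1}\<close> unfolding C1_L2_def by blast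
    then show ?thesis
      unfolding time_deriv_def by (rule someI[of "\<lambda>d. has_L2_time_deriv ?S u d t"])
  qed
  define U where "U t = exp (?m * t) * ?I (u t)" for t
  define U' where "U' t = exp (?m * t) * (?I (time_deriv ?S u t) + ?m * ?I (u t))" for t
  have U': "(U has_real_derivative U' t) (at t within {0..1})" if "t \<in> {0..1}" for t
    unfolding U_def U'_def
    by (rule derivative_eq_intros has_L2_time_deriv_inner[OF uL2 td[OF that] that mode_L2] refl | simp)+
      (simp add: algebra_simps)
  have "AE t in lebesgue_on {0<..<1}. u t \<in> sobolev 2 ?S"
    using H2 by (simp add: L2_H2_def)
  moreover have "AE t in lebesgue_on {0<..<1}. AE p in lebesgue_on ?S.
      time_deriv ?S u t p - laplacian ?S (u t) p = \<phi> t * f p"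
    using sol by (simp add: solves_source_problem_def)
  moreover have "AE t in lebesgue_on {0<..<1}.
        has_trace (\<lambda>y. (0, y)) (weak_deriv unit_square (1, 0) (u t)) (\<lambda>_. 0) \<and>
        has_trace (\<lambda>y. (1, y)) (weak_deriv unit_square (1, 0) (u t)) (\<lambda>_. 0) \<and>
        has_trace (\<lambda>x. (x, 0)) (weak_deriv unit_square (0, 1) (u t)) (\<lambda>_. 0) \<and>
        has_trace (\<lambda>x. (x, 1)) (weak_deriv unit_square (0, 1) (u t)) (\<lambda>_. 0) \<and>
        has_trace (\<lambda>y. (1, y)) (u t) (\<lambda>_. 0)"
    using sol unfolding solves_source_problem_def by blast
  ultimately have "AE t in lebesgue_on {0<..<1}. t \<in> {0..1} \<longrightarrow> U' t = ?I f * (exp (?m * t) * \<phi> t)"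
  proof eventually_elim
    case (elim t)
    show ?case
    proof
      assume t: "t \<in> {0..1}"
      have dL2: "time_deriv ?S u t \<in> L2 ?S"
        using td[OF t] by (simp add: has_L2_time_deriv_def)
      note lap = integral_laplacian_mode[OF elim(1)]
      have lapL2: "laplacian ?S (u t) \<in> L2 ?S"
        using elim(3) by (intro lap(1)) auto
      have "?I (time_deriv ?S u t) - ?I (laplacian ?S (u t))
          = (LINT p|lebesgue_on ?S. (time_deriv ?S u t p - laplacian ?S (u t) p) * ?w p)"
        by (simp add: left_diff_distrib L2_mult_integrable dL2 lapL2 mode_L2)
      also have "\<dots> = (LINT p|lebesgue_on ?S. (\<phi> t * f p) * ?w p)"
      proof (rule integral_cong_AE)
        show "AE p in lebesgue_on ?S. (time_deriv ?S u t p - laplacian ?S (u t) p) * ?w p = (\<phi> t * f p) * ?w p"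
          using elim(2) by eventually_elim simp
      qed (intro borel_measurable_times L2_measurable L2_diff L2_cmult dL2 lapL2 mode_L2 f)+
      also have "\<dots> = \<phi> t * ?I f"
        by (simp add: mult.assoc)
      finally have "?I (time_deriv ?S u t) = ?I (laplacian ?S (u t)) + \<phi> t * ?I f"
        by simp
      moreover have "?I (laplacian ?S (u t)) = - ?m * ?I (u t)"
        using elim(3) by (subst lap(2)) (auto simp: m_def)
      ultimately show "U' t = ?I f * (exp (?m * t) * \<phi> t)"
        by (simp add: U'_def)
    qed
  qed
  then obtain N where N: "negligible N"
    "\<And>t. t \<in> {0<..<1} - N \<Longrightarrow> U' t = ?I f * (exp (?m * t) * \<phi> t)"
    by (rule AE_lebesgue_on_negligible) auto
  \<comment> \<open>\<open>U\<close> is differentiable at every point of \<open>[0, 1]\<close>, so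
    the gauge integral needs no integrability argument for \<open>U'\<close>; the equation enters
    only afterwards.\<close>
  have "(U' has_integral U s - U 0) {0..s}"
    using s
    by (intro fundamental_theorem_of_calculus)
      (auto simp flip: has_real_derivative_iff_has_vector_derivative
        intro!: has_field_derivative_subset[OF U'])
  then have "U s - U 0 = integral {0..s} U'"
    by (simp add: integral_unique)
  also have "\<dots> = integral {0..s} (\<lambda>t. ?I f * (exp (?m * t) * \<phi> t))"
    \<comment> \<open>The equation determines \<open>U'\<close> off a negligible set in the open
      interval; the endpoints are added to that set.\<close>
    by (rule integral_spike[of "N \<union> {0, 1}"]) (use N s in auto)
  also have "\<dots> = ?I f * integral {0..s} (\<lambda>t. exp (?m * t) * \<phi> t)"
    by simp
  finally show ?thesis
    by (simp add: U_def mult.commute)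
qed

subsection \<open>Completeness of the modes\<close>

lemma integrable_mult_continuous_unit_square:
  fixes g h :: "real \<times> real \<Rightarrow> real"
  assumes "integrable (lebesgue_on unit_square) h" "continuous_on UNIV g"
  shows "integrable (lebesgue_on unit_square) (\<lambda>p. h p * g p)"
proof -
  have "compact (g ` cbox (0, 0) (1, 1))"
    by (intro compact_continuous_image continuous_on_subset[OF assms(2)]) auto
  then have "bounded (g ` cbox (0, 0) (1, 1))"
    by (rule compact_imp_bounded)
  then obtain B where B: "\<And>p. p \<in> cbox (0, 0) (1, 1) \<Longrightarrow> \<bar>g p\<bar> \<le> B"
    unfolding bounded_iff by auto
  show ?thesis
  proof (rule Bochner_Integration.integrable_bound[where f = "\<lambda>p. B * h p"])
    show "(\<lambda>p. h p * g p) \<in> borel_measurable (lebesgue_on unit_square)"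
      using assms by (intro borel_measurable_times borel_measurable_integrable L2_measurable continuous_L2_unit_square)
    show "AE p in lebesgue_on unit_square. norm (h p * g p) \<le> norm (B * h p)"
    proof (rule AE_I2)
      fix p assume "p \<in> space (lebesgue_on unit_square)"
      then have "\<bar>g p\<bar> \<le> \<bar>B\<bar>"
        using B[of p] by (force simp: unit_square_def)
      then show "norm (h p * g p) \<le> norm (B * h p)"
        using mult_right_mono[of "\<bar>g p\<bar>" "\<bar>B\<bar>" "\<bar>h p\<bar>"] by (simp add: abs_mult mult.commute)
    qed
  qed (use assms in simp)
qed

text \<open>The integral against \<open>mode l n\<close> is an entire function of \<open>l\<close>; its Taylor coefficients are the
  even moments.\<close>

lemma even_moments_zero:
  assumes h: "integrable (lebesgue_on unit_square) h" and "a < b"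
    and zero: "\<And>l. a < l \<Longrightarrow> l < b \<Longrightarrow> (LINT p|lebesgue_on unit_square. h p * mode l n p) = 0"
  shows "(LINT p|lebesgue_on unit_square. h p * (fst p ^ (2 * k) * cos (real n * pi * snd p))) = 0"
proof -
  let ?M = "lebesgue_on unit_square"
  define C where "C = (\<lambda>p :: real \<times> real. cos (real n * pi * snd p))"
  define q where "q j = (\<lambda>p. h p * (fst p ^ j * C p))" for j
  \<comment> \<open>The Taylor coefficients in \<open>l\<close> of the integral against
    \<open>mode l n\<close>; the odd ones vanish because cosh is even. On the square
    \<open>fst p ^ j \<le> 1\<close>, so \<open>c j\<close> decays like \<open>1 / fact j\<close>
    and the series is entire.\<close>
  define c where "c j = (if even j then (LINT p|?M. q j p) / fact j else 0)" for j
  have qi: "integrable ?M (q j)" for j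
    unfolding q_def C_def by (intro integrable_mult_continuous_unit_square h continuous_intros)
  have qle: "\<bar>q j p\<bar> \<le> \<bar>h p\<bar>" if "p \<in> unit_square" for j p
  proof -
    have "\<bar>fst p ^ j\<bar> \<le> 1"
      using that by (auto simp: unit_square_def power_le_one)
    moreover have "\<bar>C p\<bar> \<le> 1"
      by (simp add: C_def)
    ultimately have "\<bar>fst p ^ j * C p\<bar> \<le> 1"
      unfolding abs_mult by (intro mult_le_one) auto
    then show ?thesis
      by (simp add: q_def abs_mult mult_left_le)
  qed
  let ?I = "LINT p|?M. \<bar>h p\<bar>"
  have qI: "(LINT p|?M. \<bar>q j p\<bar>) \<le> ?I" for j
    using h qi qle by (intro integral_mono) auto
  have c_bound: "\<bar>c j\<bar> \<le> ?I / fact j" for j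
  proof -
    have "\<bar>LINT p|?M. q j p\<bar> \<le> ?I"
      using integral_abs_bound[of ?M "q j"] qI[of j] by linarith
    then show ?thesis
      by (auto simp: c_def divide_right_mono)
  qed
  have sums_real: "(\<lambda>j. c j * l ^ j) sums (LINT p|?M. h p * mode l n p)" for l
  proof -
    define F where "F j p = (if even j then l ^ j / fact j else 0) * q j p" for j p
    have Fi: "integrable ?M (F j)" for j
      unfolding F_def by (intro integrable_mult_right qi)
    \<comment> \<open>Termwise integration is licensed by the majorant
      \<open>\<bar>l\<bar> ^ j / fact j * \<bar>h p\<bar>\<close>.\<close>
    have "(\<lambda>j. LINT p|?M. F j p) sums (LINT p|?M. (\<Sum>j. F j p))"
    proof (rule sums_integral)
      show "integrable ?M (F j)" for j
        by (rule Fi)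
      have le: "\<bar>F j p\<bar> \<le> \<bar>l\<bar> ^ j / fact j * \<bar>q j p\<bar>" for j p
        by (auto simp: F_def abs_mult power_abs)
      have exps: "summable (\<lambda>j. \<bar>l\<bar> ^ j / fact j)"
        using summable_exp_generic[of "\<bar>l\<bar>"] by (simp add: divide_inverse mult.commute)
      show "AE p in ?M. summable (\<lambda>j. norm (F j p))"
      proof (rule AE_I2)
        fix p assume "p \<in> space ?M"
        then have p: "p \<in> unit_square"
          by simp
        show "summable (\<lambda>j. norm (F j p))"
        proof (rule summable_comparison_test'[where g = "\<lambda>j. \<bar>l\<bar> ^ j / fact j * \<bar>h p\<bar>"])
          show "summable (\<lambda>j. \<bar>l\<bar> ^ j / fact j * \<bar>h p\<bar>)"
            by (intro summable_mult2 exps)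
          show "norm (norm (F j p)) \<le> \<bar>l\<bar> ^ j / fact j * \<bar>h p\<bar>" for j
            using le[of j p] mult_left_mono[OF qle[OF p, of j], of "\<bar>l\<bar> ^ j / fact j"] by simp
        qed
      qed
      show "summable (\<lambda>j. LINT p|?M. norm (F j p))"
      proof (rule summable_comparison_test'[where g = "\<lambda>j. \<bar>l\<bar> ^ j / fact j * ?I"])
        show "summable (\<lambda>j. \<bar>l\<bar> ^ j / fact j * ?I)"
          by (intro summable_mult2 exps)
        show "norm (LINT p|?M. norm (F j p)) \<le> \<bar>l\<bar> ^ j / fact j * ?I" for j
        proof -
          have "(LINT p|?M. \<bar>F j p\<bar>) \<le> (LINT p|?M. \<bar>l\<bar> ^ j / fact j * \<bar>q j p\<bar>)"
            using le Fi[of j] qi[of j] by (intro integral_mono) auto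
          also have "\<dots> \<le> \<bar>l\<bar> ^ j / fact j * ?I"
            using mult_left_mono[OF qI[of j], of "\<bar>l\<bar> ^ j / fact j"] by simp
          finally show ?thesis
            by simp
        qed
      qed
    qed
    moreover have "(LINT p|?M. F j p) = c j * l ^ j" for j
      by (simp add: F_def c_def)
    moreover have "(\<Sum>j. F j p) = h p * mode l n p" for p
    proof -
      have "(\<lambda>j. (h p * C p) * (if even j then (l * fst p) ^ j /\<^sub>R fact j else 0)) sums ((h p * C p) * cosh (l * fst p))"
        by (intro sums_mult cosh_converges)
      moreover have "(h p * C p) * (if even j then (l * fst p) ^ j /\<^sub>R fact j else 0) = F j p" for j
        by (simp add: F_def q_def power_mult_distrib divide_inverse)
      ultimately have "(\<lambda>j. F j p) sums (h p * C p * cosh (l * fst p))"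
        by simp
      then show ?thesis
        by (simp add: sums_iff mode_def C_def)
    qed
    ultimately show ?thesis
      by simp
  qed
  \<comment> \<open>Passing to complex arguments makes the identity theorem available; the zeros in
    the real interval accumulate at its midpoint.\<close>
  define f where "f z = (\<Sum>j. complex_of_real (c j) * z ^ j)" for z
  have sums_f: "(\<lambda>j. complex_of_real (c j) * z ^ j) sums f z" for z
    unfolding f_def
  proof (rule summable_sums, rule summable_comparison_test'[where g = "\<lambda>j. ?I * (norm z ^ j / fact j)"])
    show "summable (\<lambda>j. ?I * (norm z ^ j / fact j))"
      using summable_exp_generic[of "norm z"] by (intro summable_mult) (simp add: divide_inverse mult.commute)
    show "norm (complex_of_real (c j) * z ^ j) \<le> ?I * (norm z ^ j / fact j)" for j
      using mult_right_mono[OF c_bound[of j], of "norm z ^ j"] by (simp add: norm_mult norm_power)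
  qed
  have f0: "f z = 0" for z
  proof (rule analytic_continuation[where f = f and S = UNIV and U = "complex_of_real ` {a<..<b}" and \<xi> = "complex_of_real ((a + b) / 2)"])
    have "f holomorphic_on ball 0 r" for r
      by (rule power_series_holomorphic[where a = "\<lambda>j. complex_of_real (c j)"]) (simp add: sums_f)
    then show "f holomorphic_on UNIV"
      unfolding holomorphic_on_def
      by (metis UNIV_I at_within_open dist_0_norm mem_ball open_UNIV open_ball gt_ex)
    show "complex_of_real ((a + b) / 2) islimpt complex_of_real ` {a<..<b}"
      unfolding islimpt_approachable
    proof (intro allI impI)
      fix e :: real assume "e > 0"
      obtain t where "0 < t" "t < min e ((b - a) / 2)"
        using dense[of 0 "min e ((b - a) / 2)"] \<open>e > 0\<close> \<open>a < b\<close> by auto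
      then have t: "0 < t" "t < e" "t < (b - a) / 2"
        by simp_all
      have "(a + b) / 2 + t \<in> {a<..<b}"
        using t \<open>a < b\<close> by (simp add: field_simps)
      moreover have "complex_of_real ((a + b) / 2 + t) \<noteq> complex_of_real ((a + b) / 2)"
        unfolding of_real_eq_iff using t by linarith
      moreover have "dist (complex_of_real ((a + b) / 2 + t)) (complex_of_real ((a + b) / 2)) < e"
        unfolding dist_of_real dist_real_def using t by linarith
      ultimately show "\<exists>z\<in>complex_of_real ` {a<..<b}. z \<noteq> complex_of_real ((a + b) / 2) \<and>
          dist z (complex_of_real ((a + b) / 2)) < e"
        by blast
    qed
    show "f z = 0" if z: "z \<in> complex_of_real ` {a<..<b}" for z
    proof -
      obtain l where l: "z = complex_of_real l" "a < l" "l < b"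
        using z by auto
      have "(\<lambda>j. complex_of_real (c j * l ^ j)) sums complex_of_real 0"
        using sums_real[of l] zero[OF l(2,3)] by (subst sums_of_real_iff) simp
      then show ?thesis
        using sums_f[of z] by (auto simp: l dest: sums_unique2)
    qed
  qed auto
  have "c j = 0" for j
  proof (rule ccontr)
    assume "c j \<noteq> 0"
    moreover have "c 0 = 0"
      using sums_f[of 0] f0[of 0] by (simp add: sums_iff)
    ultimately have "j > 0"
      by (metis gr0I)
    \<comment> \<open>A nonzero coefficient would make 0 an isolated zero, contradicting that
      \<open>f\<close> vanishes identically.\<close>
    obtain s where "0 < s" "\<And>z. z \<in> cball 0 s - {0} \<Longrightarrow> f z \<noteq> 0"
      by (rule powser_0_nonzero[of 1 0 "\<lambda>j. complex_of_real (c j)" f j])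
        (use sums_f f0 \<open>c j \<noteq> 0\<close> \<open>j > 0\<close> in auto)
    from this(2)[of "of_real s"] show False
      using f0 \<open>0 < s\<close> by simp
  qed
  from this[of "2 * k"] show ?thesis
    by (simp add: c_def q_def C_def)
qed

text \<open>The linear span of the functions in the even moments. It is the algebra to which
  Stone--Weierstrass is applied.\<close>

inductive even_cos :: "(real \<times> real \<Rightarrow> real) \<Rightarrow> bool" where
  monom: "even_cos (\<lambda>p. a * (fst p ^ (2 * k) * cos (real n * pi * snd p)))"
| add: "even_cos g \<Longrightarrow> even_cos h \<Longrightarrow> even_cos (\<lambda>p. g p + h p)"

lemma continuous_even_cos: "even_cos g \<Longrightarrow> continuous_on A g"
  by (induction rule: even_cos.induct) (auto intro!: continuous_intros)

text \<open>The product-to-sum formula for cosines keeps products in the span. The frequency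
  difference is taken in absolute value because frequencies are naturals.\<close>

lemma even_cos_mult_monom:
  assumes "even_cos g"
  shows "even_cos (\<lambda>p. g p * (a * (fst p ^ (2 * k) * cos (real n * pi * snd p))))"
  using assms
proof induction
  case (monom b i m)
  have "(\<lambda>p. b * (fst p ^ (2 * i) * cos (real m * pi * snd p)) * (a * (fst p ^ (2 * k) * cos (real n * pi * snd p))))
    = (\<lambda>p. (a * b / 2) * (fst p ^ (2 * (i + k)) * cos (real (m + n) * pi * snd p))
       + (a * b / 2) * (fst p ^ (2 * (i + k)) * cos (real (nat \<bar>int m - int n\<bar>) * pi * snd p)))"
  proof
    fix p :: "real \<times> real"
    have "cos (real (nat \<bar>int m - int n\<bar>) * pi * snd p) = cos (real m * pi * snd p - real n * pi * snd p)"
    proof (cases "n \<le> m")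
      case True
      then show ?thesis by (simp add: nat_diff_distrib of_nat_diff algebra_simps)
    next
      case False
      then have "real (nat \<bar>int m - int n\<bar>) * pi * snd p = - (real m * pi * snd p - real n * pi * snd p)"
        by (simp add: algebra_simps)
      then show ?thesis by (simp only: cos_minus)
    qed
    moreover have "cos (real (m + n) * pi * snd p) = cos (real m * pi * snd p + real n * pi * snd p)"
      by (simp add: algebra_simps)
    ultimately show "b * (fst p ^ (2 * i) * cos (real m * pi * snd p)) * (a * (fst p ^ (2 * k) * cos (real n * pi * snd p)))
      = (a * b / 2) * (fst p ^ (2 * (i + k)) * cos (real (m + n) * pi * snd p))
       + (a * b / 2) * (fst p ^ (2 * (i + k)) * cos (real (nat \<bar>int m - int n\<bar>) * pi * snd p))"
      by (simp only: cos_add cos_diff power_add distrib_left) (simp add: field_simps)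
  qed
  then show ?case
    by (simp only: even_cos.intros)
next
  case (add g h)
  then show ?case
    by (simp only: distrib_right even_cos.add)
qed

lemma even_cos_mult:
  assumes "even_cos g" "even_cos h"
  shows "even_cos (\<lambda>p. g p * h p)"
  using assms(2)
proof induction
  case (monom a k n)
  show ?case
    by (rule even_cos_mult_monom[OF assms(1)])
next
  case (add h h')
  then show ?case
    by (simp only: distrib_left even_cos.add)
qed

text \<open>The interval of \<open>l\<close> may depend on \<open>n\<close>: the passage to moments
  treats each frequency separately.\<close>

lemma AE_zero_if_orthogonal_modes:
  assumes h: "integrable (lebesgue_on unit_square) h"
    and zero: "\<And>n. \<exists>a b. a < b \<and> (\<forall>l. a < l \<longrightarrow> l < b \<longrightarrow> (LINT p|lebesgue_on unit_square. h p * mode l n p) = 0)"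
  shows "AE p in lebesgue_on unit_square. h p = 0"
proof (rule AE_zero_if_orthogonal_test_functions[OF h])
  fix g assume g: "test_function unit_square g"
  have even: "(LINT p|lebesgue_on unit_square. h p * g p) = 0" if "even_cos g" for g
    using that
  proof induction
    case (monom a k n)
    have "(LINT p|lebesgue_on unit_square. h p * (fst p ^ (2 * k) * cos (real n * pi * snd p))) = 0"
      using zero[of n] even_moments_zero[OF h] by blast
    then show ?case
      by (simp only: mult.left_commute[of _ a] integral_mult_right_zero)
  next
    case (add g1 g2)
    then show ?case
      by (simp add: distrib_left integrable_mult_continuous_unit_square[OF h] continuous_even_cos)
  qed
  show "(LINT p|lebesgue_on unit_square. h p * g p) = 0"
  proof (rule integral_mult_continuous_zero[where P = even_cos and K = "cbox (0, 0) (1, 1)", OF _ _ _ h])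
    show "unit_square \<subseteq> cbox (0, 0) (1, 1)"
      by (auto simp: unit_square_def)
    show "even_cos (\<lambda>_. c)" for c
      using even_cos.monom[of c 0 0] by simp
    \<comment> \<open>Even powers and cosines suffice because \<open>x\<^sup>2\<close> is injective
      for \<open>x \<ge> 0\<close> and \<open>cos (pi * y)\<close> on \<open>[0, 1]\<close>.\<close>
    show "\<exists>g. even_cos g \<and> g p \<noteq> g q"
      if p: "p \<in> cbox (0, 0) (1, 1)" and q: "q \<in> cbox (0, 0) (1, 1)" and "p \<noteq> q" for p q
    proof (cases "fst p = fst q")
      case True
      then have "snd p \<noteq> snd q"
        using \<open>p \<noteq> q\<close> by (simp add: prod_eq_iff)
      then have "cos (pi * snd p) \<noteq> cos (pi * snd q)"
        using p q cos_inj_pi[of "pi * snd p" "pi * snd q"] by (cases p; cases q) auto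
      then show ?thesis
        using even_cos.monom[of 1 0 1] by (intro exI[of _ "\<lambda>p. cos (pi * snd p)"]) simp
    next
      case False
      then have "fst p ^ 2 \<noteq> fst q ^ 2"
        using p q by (cases p; cases q) (auto simp: power2_eq_iff)
      then show ?thesis
        using even_cos.monom[of 1 1 0] by (intro exI[of _ "\<lambda>p. fst p ^ 2"]) simp
    qed
    show "continuous_on (cbox (0, 0) (1, 1)) g"
      using test_function_continuous[OF g] by (rule continuous_on_subset) simp
  qed (auto intro: continuous_even_cos even_cos.add even_cos_mult even)
qed

subsection \<open>The Laplace transform of the time factor\<close>

lemma continuous_on_flat: "c > 0 \<Longrightarrow> continuous_on A (flat c P)"
  using DERIV_isCont[OF flat_deriv] by (auto intro: continuous_at_imp_continuous_on)

text \<open>\<open>exp (- t)\<close> is injective, so polynomials in it form a separating algebra on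
  \<open>[0, 1]\<close>. Orthogonality thus extends to continuous functions, and from these to
  indicators of intervals.\<close>

lemma AE_zero_if_orthogonal_exp:
  fixes f :: "real \<Rightarrow> real"
  assumes f: "integrable (lebesgue_on {0<..<1}) f"
    and zero: "\<And>k. (LINT t|lebesgue_on {0<..<1}. f t * exp (- t) ^ k) = 0"
  shows "AE t in lebesgue_on {0<..<1}. f t = 0"
proof -
  let ?M = "lebesgue_on {0<..<1::real}"
  define P where "P g \<longleftrightarrow> (\<exists>Q. g = (\<lambda>t. poly Q (exp (- t))))" for g :: "real \<Rightarrow> real"
  have cont_zero: "(LINT t|?M. f t * g t) = 0" if g: "continuous_on UNIV g" for g
  proof (rule integral_mult_continuous_zero[where P = P and K = "{0..1}", OF _ _ _ f])
    show "P (\<lambda>_. c)" for c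
      unfolding P_def by (rule exI[of _ "[:c:]"]) simp
    show "continuous_on {0..1} g" if "P g" for g
      using that by (auto simp: P_def intro!: continuous_intros)
    show "P (\<lambda>t. g t + h t)" "P (\<lambda>t. g t * h t)" if "P g" "P h" for g h
      using that unfolding P_def by (metis poly_add, metis poly_mult)
    show "\<exists>g. P g \<and> g x \<noteq> g y" if "x \<noteq> y" for x y
    proof (intro exI conjI)
      show "P (\<lambda>t. exp (- t))"
        unfolding P_def by (rule exI[of _ "[:0, 1:]"]) simp
    qed (use that in simp)
    show "(LINT t|?M. f t * g t) = 0" if Pg: "P g" for g
    proof -
      have int: "integrable ?M (\<lambda>t. f t * exp (- t) ^ k)" for k
      proof (rule Bochner_Integration.integrable_bound[OF f])
        have "(\<lambda>t. exp (- t) ^ k) \<in> borel_measurable ?M"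
          by (intro continuous_imp_measurable_on_sets_lebesgue continuous_intros) simp
        then show "(\<lambda>t. f t * exp (- t) ^ k) \<in> borel_measurable ?M"
          using f by (intro borel_measurable_times) auto
        show "AE t in ?M. norm (f t * exp (- t) ^ k) \<le> norm (f t)"
          by (intro AE_I2) (auto simp: abs_mult intro!: mult_left_le power_le_one)
      qed
      obtain Q where g: "g = (\<lambda>t. poly Q (exp (- t)))"
        using Pg by (auto simp: P_def)
      have "(LINT t|?M. f t * g t) = (LINT t|?M. (\<Sum>i\<le>degree Q. coeff Q i * (f t * exp (- t) ^ i)))"
        by (simp add: g poly_altdef sum_distrib_left mult.left_commute)
      also have "\<dots> = (\<Sum>i\<le>degree Q. coeff Q i * (LINT t|?M. f t * exp (- t) ^ i))"
        by (subst Bochner_Integration.integral_sum) (auto intro: int)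
      finally show ?thesis
        by (simp add: zero)
    qed
    show "continuous_on {0..1} g"
      using g by (rule continuous_on_subset) simp
  qed auto
  show ?thesis
  proof (rule AE_zero_if_integral_box_zero[OF _ f])
    fix a b :: real
    define h where "h n t = flat (1 / Suc n) 1 (t - a - 1 / Suc n) * flat (1 / Suc n) 1 (b - t - 1 / Suc n)" for n t
    have hc: "continuous_on UNIV (h n)" for n
      unfolding h_def by (intro continuous_intros continuous_on_compose2[OF continuous_on_flat[of _ UNIV]]) auto
    have fm: "f \<in> borel_measurable ?M"
      using f by simp
    have hm: "h n \<in> borel_measurable ?M" for n
      using hc[of n] by (intro continuous_imp_measurable_on_sets_lebesgue) (auto intro: continuous_on_subset)
    have hb: "\<bar>h n t\<bar> \<le> 1" for n t
    proof -
      have "0 \<le> flat (1 / Suc n) 1 x \<and> flat (1 / Suc n) 1 x \<le> 1" for x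
        by (rule flat_one_bounds) simp
      then show ?thesis
        unfolding h_def abs_mult by (intro mult_le_one) auto
    qed
    have hl: "(\<lambda>n. f t * h n t) \<longlonglongrightarrow> f t * indicator (box a b) t" for t
    proof -
      have "(\<lambda>n. h n t) \<longlonglongrightarrow> indicator {0<..} (t - a) * indicator {0<..} (b - t)"
        unfolding h_def by (intro tendsto_mult flat_one_tendsto_indicator)
      moreover have "indicator {0<..} (t - a) * indicator {0<..} (b - t) = indicat_real (box a b) t"
        by (simp add: indicator_def box_real)
      ultimately show ?thesis
        by (simp add: tendsto_mult_left)
    qed
    have "(\<lambda>n. LINT t|?M. f t * h n t) \<longlonglongrightarrow> (LINT t|?M. f t * indicator (box a b) t)"
    proof (rule integral_dominated_convergence[where w = "\<lambda>t. norm (f t)"])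
      show fh: "(\<lambda>t. f t * h n t) \<in> borel_measurable ?M" for n
        using fm hm by (rule borel_measurable_times)
      show "(\<lambda>t. f t * indicator (box a b) t) \<in> borel_measurable ?M"
        by (rule borel_measurable_LIMSEQ_real[OF hl fh])
      show "AE t in ?M. (\<lambda>n. f t * h n t) \<longlonglongrightarrow> f t * indicator (box a b) t"
        by (intro AE_I2 hl)
      show "AE t in ?M. norm (f t * h n t) \<le> norm (f t)" for n
        using hb by (intro AE_I2) (simp add: abs_mult mult_left_le)
    qed (use f in simp)
    then have "(LINT t|?M. f t * indicator (box a b) t) = 0"
      unfolding cont_zero[OF hc] by (rule LIMSEQ_unique[OF _ tendsto_const])
    then show "(LINT t|?M. indicator (box a b) t * f t) = 0"
      by (simp add: mult.commute)
  qed simp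
qed

lemma integral_exp_mult_eq:
  fixes \<phi> :: "real \<Rightarrow> real"
  assumes "integrable (lebesgue_on {0<..<1}) \<phi>"
  shows "integrable (lebesgue_on {0<..<1}) (\<lambda>t. exp (m * t) * \<phi> t)"
    and "integral {0..1} (\<lambda>t. exp (m * t) * \<phi> t) = (LINT t|lebesgue_on {0<..<1}. exp (m * t) * \<phi> t)"
proof -
  let ?M = "lebesgue_on {0<..<1::real}"
  show int: "integrable ?M (\<lambda>t. exp (m * t) * \<phi> t)"
  proof (rule Bochner_Integration.integrable_bound[where f = "\<lambda>t. exp \<bar>m\<bar> * \<phi> t"])
    have "(\<lambda>t. exp (m * t)) \<in> borel_measurable ?M"
      by (intro continuous_imp_measurable_on_sets_lebesgue continuous_intros) simp
    then show "(\<lambda>t. exp (m * t) * \<phi> t) \<in> borel_measurable ?M"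
      using assms by (intro borel_measurable_times) auto
    show "AE t in ?M. norm (exp (m * t) * \<phi> t) \<le> norm (exp \<bar>m\<bar> * \<phi> t)"
    proof (rule AE_I2)
      fix t assume "t \<in> space ?M"
      then have "\<bar>m * t\<bar> \<le> \<bar>m\<bar>"
        by (auto simp: abs_mult mult_left_le)
      then have "m * t \<le> \<bar>m\<bar>"
        by linarith
      then show "norm (exp (m * t) * \<phi> t) \<le> norm (exp \<bar>m\<bar> * \<phi> t)"
        by (simp add: abs_mult mult_right_mono)
    qed
  qed (use assms in simp)
  then have "(LINT t|?M. exp (m * t) * \<phi> t) = integral (box 0 1) (\<lambda>t. exp (m * t) * \<phi> t)"
    by (simp add: lebesgue_integral_eq_integral box_real)
  then show "integral {0..1} (\<lambda>t. exp (m * t) * \<phi> t) = (LINT t|?M. exp (m * t) * \<phi> t)"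
    using integral_open_interval[of "0::real" 1 "\<lambda>t. exp (m * t) * \<phi> t"] by (simp add: box_real)
qed

text \<open>Dominated convergence along sequences: convergent parameters are bounded by some
  \<open>B\<close>, which gives the majorant \<open>exp B * \<bar>\<phi> t\<bar>\<close>.\<close>

lemma isCont_integral_exp_mult:
  fixes \<phi> :: "real \<Rightarrow> real"
  assumes \<phi>: "integrable (lebesgue_on {0<..<1}) \<phi>"
  shows "isCont (\<lambda>m. LINT t|lebesgue_on {0<..<1}. exp (m * t) * \<phi> t) m"
  unfolding continuous_at_sequentially comp_def
proof (intro allI impI)
  fix x :: "nat \<Rightarrow> real" assume x: "x \<longlonglongrightarrow> m"
  let ?M = "lebesgue_on {0<..<1::real}"
  obtain B where B: "\<And>n. \<bar>x n\<bar> \<le> B"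
    using convergent_imp_Bseq[OF convergentI[OF x]] by (auto simp: Bseq_def)
  show "(\<lambda>n. LINT t|?M. exp (x n * t) * \<phi> t) \<longlonglongrightarrow> (LINT t|?M. exp (m * t) * \<phi> t)"
  proof (rule integral_dominated_convergence[where w = "\<lambda>t. exp B * \<bar>\<phi> t\<bar>"])
    show "AE t in ?M. (\<lambda>n. exp (x n * t) * \<phi> t) \<longlonglongrightarrow> exp (m * t) * \<phi> t"
      by (intro AE_I2 tendsto_intros x)
    show "AE t in ?M. norm (exp (x n * t) * \<phi> t) \<le> exp B * \<bar>\<phi> t\<bar>" for n
    proof (rule AE_I2)
      fix t assume "t \<in> space ?M"
      then have "\<bar>x n * t\<bar> \<le> \<bar>x n\<bar>"
        by (auto simp: abs_mult mult_left_le)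
      then have "x n * t \<le> B"
        using B[of n] by linarith
      then show "norm (exp (x n * t) * \<phi> t) \<le> exp B * \<bar>\<phi> t\<bar>"
        by (simp add: abs_mult mult_right_mono)
    qed
    show "(\<lambda>t. exp (x n * t) * \<phi> t) \<in> borel_measurable ?M" "(\<lambda>t. exp (m * t) * \<phi> t) \<in> borel_measurable ?M" for n
      by (intro borel_measurable_integrable integral_exp_mult_eq(1)[OF \<phi>])+
  qed (use \<phi> in simp)
qed

lemma laplace_transform_nonzero_interval:
  fixes \<phi> :: "real \<Rightarrow> real"
  assumes \<phi>: "integrable (lebesgue_on {0<..<1}) \<phi>" and nz: "\<not> (AE t in lebesgue_on {0<..<1}. \<phi> t = 0)"
  shows "\<exists>a b. a < b \<and> (\<forall>l. a < l \<longrightarrow> l < b \<longrightarrow> integral {0..1} (\<lambda>t. exp (((real n * pi)\<^sup>2 - l\<^sup>2) * t) * \<phi> t) \<noteq> 0)"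
proof -
  let ?M = "lebesgue_on {0<..<1::real}"
  let ?D = "\<lambda>m. LINT t|?M. exp (m * t) * \<phi> t"
  obtain k where k: "?D (- real k) \<noteq> 0"
  proof (rule ccontr)
    assume "\<not> thesis"
    then have "?D (- real k) = 0" for k
      using that by blast
    then have "AE t in ?M. \<phi> t = 0"
      by (intro AE_zero_if_orthogonal_exp[OF \<phi>]) (simp add: mult.commute flip: exp_of_nat_mult)
    then show False
      using nz by simp
  qed
  \<comment> \<open>This solves \<open>(real n * pi)\<^sup>2 - l0\<^sup>2 = - real k\<close>; the
    sign of the right-hand side keeps the radicand nonnegative for every \<open>n\<close>.\<close>
  define l0 where "l0 = sqrt ((real n * pi)\<^sup>2 + real k)"
  have l0: "(real n * pi)\<^sup>2 - l0\<^sup>2 = - real k"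
    by (simp add: l0_def)
  have "isCont (\<lambda>l. ?D ((real n * pi)\<^sup>2 - l\<^sup>2)) l0"
    by (rule isCont_o2[OF _ isCont_integral_exp_mult[OF \<phi>]]) (intro continuous_intros)
  then obtain e where e: "e > 0" "\<And>l. dist l0 l < e \<Longrightarrow> ?D ((real n * pi)\<^sup>2 - l\<^sup>2) \<noteq> 0"
    using continuous_at_avoid[of l0 "\<lambda>l. ?D ((real n * pi)\<^sup>2 - l\<^sup>2)" 0] k by (auto simp: l0)
  show ?thesis
    using e by (intro exI[of _ "l0 - e"] exI[of _ "l0 + e"])
      (auto simp: integral_exp_mult_eq(2)[OF \<phi>] dist_real_def abs_less_iff)
qed

subsection \<open>Uniqueness\<close>

lemma solution_initial_final_modes:
  assumes sol: "solves_source_problem \<phi> g0 g1 u f" and g: "g0 \<in> L2 unit_square" "g1 \<in> L2 unit_square"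
  shows "(LINT p|lebesgue_on unit_square. u 0 p * mode l n p) = (LINT p|lebesgue_on unit_square. g0 p * mode l n p)"
    and "(LINT p|lebesgue_on unit_square. u 1 p * mode l n p) = (LINT p|lebesgue_on unit_square. g1 p * mode l n p)"
proof -
  have u: "u 0 \<in> L2 unit_square" "u 1 \<in> L2 unit_square"
    using sol by (auto simp: solves_source_problem_def C1_L2_def)
  have ae: "AE p in lebesgue_on unit_square. u 0 p = g0 p" "AE p in lebesgue_on unit_square. u 1 p = g1 p"
    using sol unfolding solves_source_problem_def by blast+
  have "(LINT p|lebesgue_on unit_square. v p * mode l n p) = (LINT p|lebesgue_on unit_square. g p * mode l n p)"
    if "v \<in> L2 unit_square" "g \<in> L2 unit_square" "AE p in lebesgue_on unit_square. v p = g p" for v g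
  proof (rule integral_cong_AE)
    show "AE p in lebesgue_on unit_square. v p * mode l n p = g p * mode l n p"
      using that(3) by eventually_elim simp
  qed (intro borel_measurable_times L2_measurable that mode_L2)+
  then show "(LINT p|lebesgue_on unit_square. u 0 p * mode l n p) = (LINT p|lebesgue_on unit_square. g0 p * mode l n p)"
    "(LINT p|lebesgue_on unit_square. u 1 p * mode l n p) = (LINT p|lebesgue_on unit_square. g1 p * mode l n p)"
    using u g ae by blast+
qed

lemma AE_eq_if_modes_eq:
  assumes L2: "v \<in> L2 unit_square" "w \<in> L2 unit_square"
    and eq: "\<And>n. \<exists>a b. a < b \<and> (\<forall>l. a < l \<longrightarrow> l < b \<longrightarrow>
      (LINT p|lebesgue_on unit_square. v p * mode l n p) = (LINT p|lebesgue_on unit_square. w p * mode l n p))"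
  shows "AE p in lebesgue_on unit_square. v p = w p"
proof -
  have "AE p in lebesgue_on unit_square. v p - w p = 0"
  proof (rule AE_zero_if_orthogonal_modes)
    show "integrable (lebesgue_on unit_square) (\<lambda>p. v p - w p)"
      by (intro L2_unit_square_integrable L2_diff L2)
    have "(LINT p|lebesgue_on unit_square. (v p - w p) * mode l n p)
      = (LINT p|lebesgue_on unit_square. v p * mode l n p) - (LINT p|lebesgue_on unit_square. w p * mode l n p)" for l n
      by (simp add: left_diff_distrib L2_mult_integrable L2 mode_L2)
    then show "\<exists>a b. a < b \<and> (\<forall>l. a < l \<longrightarrow> l < b \<longrightarrow>
        (LINT p|lebesgue_on unit_square. (v p - w p) * mode l n p) = 0)" for n
      using eq[of n] by simp
  qed
  then show ?thesis
    by simp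
qed

theorem theorem1:
  fixes \<phi> :: "real \<Rightarrow> real"
    and g0 g1 f1 f2 :: "real \<times> real \<Rightarrow> real"
    and u1 u2 :: "real \<Rightarrow> real \<times> real \<Rightarrow> real"
  assumes "integrable (lebesgue_on {0<..<1}) \<phi>"
    and "\<not> (AE t in lebesgue_on {0<..<1}. \<phi> t = 0)"
    and "g0 \<in> L2 unit_square" and "g1 \<in> L2 unit_square"
    and "u1 \<in> C1_L2 unit_square \<inter> L2_H2 unit_square"
    and "u2 \<in> C1_L2 unit_square \<inter> L2_H2 unit_square"
    and "f1 \<in> L2 unit_square" and "f2 \<in> L2 unit_square"
    and "solves_source_problem \<phi> g0 g1 u1 f1"
    and "solves_source_problem \<phi> g0 g1 u2 f2"
  shows "(\<forall>t\<in>{0..1}. AE p in lebesgue_on unit_square. u1 t p = u2 t p) \<and>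
         (AE p in lebesgue_on unit_square. f1 p = f2 p)"
proof
  let ?I = "\<lambda>l n v. LINT p|lebesgue_on unit_square. v p * mode l n p"
  let ?m = "\<lambda>l n. (real n * pi)\<^sup>2 - l\<^sup>2"
  let ?D = "\<lambda>s l n. integral {0..s} (\<lambda>t. exp (?m l n * t) * \<phi> t)"
  note init1 = solution_initial_final_modes[OF assms(9,3,4)]
    and init2 = solution_initial_final_modes[OF assms(10,3,4)]
  have f_modes: "?I l n f1 = ?I l n f2" if "?D 1 l n \<noteq> 0" for l n
  proof -
    \<comment> \<open>At time 1 the left side of \<open>mode_evolution\<close> is determined by
      \<open>g0\<close> and \<open>g1\<close>, hence is the same for both solutions.\<close>
    have "?D 1 l n * ?I l n f1 = ?D 1 l n * ?I l n f2"
      using mode_evolution[OF assms(9), of 1 n l] mode_evolution[OF assms(10), of 1 n l]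
      unfolding init1 init2 by simp
    then show ?thesis
      using that by simp
  qed
  show f: "AE p in lebesgue_on unit_square. f1 p = f2 p"
  proof (rule AE_eq_if_modes_eq[OF assms(7,8)])
    fix n
    show "\<exists>a b. a < b \<and> (\<forall>l. a < l \<longrightarrow> l < b \<longrightarrow> ?I l n f1 = ?I l n f2)"
      using laplace_transform_nonzero_interval[OF assms(1,2), of n] f_modes by blast
  qed
  \<comment> \<open>Equality of the sources now holds for all parameters, also where the transform
    vanishes, so the source terms on \<open>[0, t]\<close> agree.\<close>
  have f_eq: "?I l n f1 = ?I l n f2" for l n
  proof (rule integral_cong_AE)
    show "AE p in lebesgue_on unit_square. f1 p * mode l n p = f2 p * mode l n p"
      using f by eventually_elim simp
  qed (intro borel_measurable_times L2_measurable assms mode_L2)+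
  show "\<forall>t\<in>{0..1}. AE p in lebesgue_on unit_square. u1 t p = u2 t p"
  proof
    fix t :: real assume t: "t \<in> {0..1}"
    have "?I l n (u1 t) = ?I l n (u2 t)" for l n
    proof -
      have "exp (?m l n * t) * ?I l n (u1 t) = exp (?m l n * t) * ?I l n (u2 t)"
        using mode_evolution[OF assms(9) t, of n l] mode_evolution[OF assms(10) t, of n l]
        unfolding init1 init2 f_eq by linarith
      then show ?thesis
        by simp
    qed
    moreover have "u1 t \<in> L2 unit_square" "u2 t \<in> L2 unit_square"
      using assms(5,6) t by (auto simp: C1_L2_def)
    \<comment> \<open>The modes of the solutions agree for every \<open>l\<close>, so
      \<open>(0, 1)\<close> serves as the interval for each \<open>n\<close>.\<close>
    ultimately show "AE p in lebesgue_on unit_square. u1 t p = u2 t p"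
      using zero_less_one by (intro AE_eq_if_modes_eq) blast+
  qed
qed

end
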